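(* Let $\mathcal S=\{f,\underline p,\bar p\}$ be a nice setup. If the cost function is $f(y)=qy$, where $q\ge0$, then there exists a unique pricing function $\phi_*$ given by $$\phi_*(y)=\begin{cases}\underline p & \text{if }y\in[0,\omega_* ),\\ (\underline p-q)\cdot\exp(y/\omega_*-1)+q & \text{if }y\in[\omega_*,1],\\+\infty & \text{if }y\in(1,+\infty),\end{cases}$$ such that $\mathsf{PM}_{\phi_*}$ is incentive compatible and $\alpha_*(\mathcal S)$-competitive, where the optimal competitive ratio $\alpha_*(\mathcal S)$ is given by $$\alpha_*(\mathcal S)=1+\ln\Big(\frac{\bar p-q}{\underline p-q}\Big),$$ and the optimal critical threshold is $\omega_*=1/\alpha_*(\mathcal S)$.
   Context: **Setup.** A setup is $\mathcal S=\{f,\underline p,\bar p\}$, consisting of a supply cost function $f$ on $[0,1]$ and bounds $\underline p\le\bar p$; this is all the information known in advance. It is *nice* if $f$ is non-decreasing, $f(0)=0$ and $f'(0)<\underline p\le\bar p$. The critical threshold is the resource utilization level separating the flat segment (price $\underline p$) of a pricing function from its increasing segment. **Model.** An arrival instance $\mathcal A=(\theta_1,\dots,\theta_N)$ is a sequence of agents arriving one by one, with types $\theta_n=(r_n,v_n)$, where $r_n$ is the resource requirement and $v_n$ the valuation, such that $\underline p\le v_n/r_n\le\bar p$ for all $n$. Every requirement is assumed very small compared with the capacity: $r_n\ll1$ (requests are treated as infinitesimal). With $x_n\in\{0,1\}$ indicating whether request $n$ is satisfied, the social welfare is $\sum_n v_nx_n-f(\sum_n r_nx_n)$ subject to $\sum_n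 r_nx_n\le1$; $S_{\rm offline}(\mathcal A)$ is its maximum given full knowledge of $\mathcal A$. An online algorithm or mechanism knows only $\mathcal S$ in advance and decides each $x_n$ irrevocably upon arrival of agent $n$; $S_{\rm online}(\mathcal A)$ is the social welfare it achieves. Its competitive ratio is $\max_{\mathcal A}S_{\rm offline}(\mathcal A)/S_{\rm online}(\mathcal A)$ over all possible $\mathcal A$; it is $\alpha$-competitive if this ratio is at most $\alpha$. The optimal competitive ratio $\alpha_*(\mathcal S)$ is the infimum of the competitive ratio over all possible online algorithms. **Posted price mechanism $\mathsf{PM}_\phi$.** Given a pricing function $\phi$, start with $\hat y_0=0$, $\hat p_0=\phi(0)$. When agent $n$ arrives: if $v_n-\hat p_{n-1}r_n<0$ or $\hat y_{n-1}+r_n>1$, set $\hat x_n=0$; otherwise $\hat x_n=1$. Agent $n$ pays $\hat p_{n-1}r_n\hat x_n$; then $\hat y_n=\hat y_{n-1}+r_n\hat x_n$ and $\hat p_n=\phi(\hat y_n)$. **Incentive compatibility.** Agents may misreport their types. The utility of agent $n$ is $v_nx_n$ minus her payment. A mechanism is incentive compatible if all agents achieve their maximum utilities by acting according to their true types.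
   Formalization: Uniqueness is claimed among pricing functions that are non-decreasing, at least the lower bound, left-continuous on (0,1] and infinite beyond 1; without this it fails, since the price at y=1 is never charged and can be changed freely. *)

theory Defs
  imports Complex_Main "HOL-Library.Extended_Real" "HOL-Library.FuncSet"
begin

record pricing_setup =
  cost :: "real \<Rightarrow> real"
  p_lo :: real
  p_hi :: real

text \<open>Only the values of the cost function on \<open>[0,1]\<close> matter; the derivative at \<open>0\<close> is
  therefore the one-sided one.\<close>

definition nice :: "pricing_setup \<Rightarrow> bool" where
  "nice S \<longleftrightarrow>
     mono_on {0..1} (cost S) \<and> cost S 0 = 0 \<and>
     (\<exists>D. (cost S has_real_derivative D) (at 0 within {0..1}) \<and> D < p_lo S) \<and>
     p_lo S \<le> p_hi S"

text \<open>An agent type \<open>(r, v)\<close> consists of a resource requirement and a valuation.\<close>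

type_synonym agent = "real \<times> real"

abbreviation req :: "agent \<Rightarrow> real" where "req \<equiv> fst"
abbreviation vln :: "agent \<Rightarrow> real" where "vln \<equiv> snd"

definition agent_types :: "pricing_setup \<Rightarrow> agent set" where
  "agent_types S = {\<theta>. 0 < req \<theta> \<and> p_lo S \<le> vln \<theta> / req \<theta> \<and> vln \<theta> / req \<theta> \<le> p_hi S}"

definition instances :: "pricing_setup \<Rightarrow> agent list set" where
  "instances S = lists (agent_types S)"

definition small_instances :: "pricing_setup \<Rightarrow> real \<Rightarrow> agent list set" where
  "small_instances S \<epsilon> = {A \<in> instances S. \<forall>\<theta>\<in>set A. req \<theta> \<le> \<epsilon>}"

text \<open>A 0/1 vector \<open>x\<close> is represented by the set \<open>X\<close> of the positions \<open>n\<close> with \<open>x\<^sub>n = 1\<close>.\<close>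

definition usage :: "agent list \<Rightarrow> nat set \<Rightarrow> real" where
  "usage A X = (\<Sum>n\<in>X. req (A ! n))"

definition welfare :: "pricing_setup \<Rightarrow> agent list \<Rightarrow> nat set \<Rightarrow> real" where
  "welfare S A X = (\<Sum>n\<in>X. vln (A ! n)) - cost S (usage A X)"

definition offline_welfare :: "pricing_setup \<Rightarrow> agent list \<Rightarrow> real" where
  "offline_welfare S A = Max {welfare S A X |X. X \<subseteq> {..<length A} \<and> usage A X \<le> 1}"

text \<open>A deterministic online algorithm decides on an agent from the list of the earlier agents
  and the agent's own type.\<close>

type_synonym decision_rule = "agent list \<Rightarrow> agent \<Rightarrow> bool"

definition accepted :: "decision_rule \<Rightarrow> agent list \<Rightarrow> nat set" where
  "accepted alg A = {n. n < length A \<and> alg (take n A) (A ! n)}"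

definition online_algorithm :: "pricing_setup \<Rightarrow> decision_rule \<Rightarrow> bool" where
  "online_algorithm S alg \<longleftrightarrow> (\<forall>A\<in>instances S. usage A (accepted alg A) \<le> 1)"

definition online_welfare :: "pricing_setup \<Rightarrow> decision_rule \<Rightarrow> agent list \<Rightarrow> real" where
  "online_welfare S alg A = welfare S A (accepted alg A)"

text \<open>The quotient of offline by online welfare, where \<open>0/0\<close> (e.g. for the empty instance) counts
  as \<open>1\<close>, and an online welfare that is not positive although the offline welfare is, as \<open>\<infinity>\<close>.\<close>

definition welfare_ratio :: "pricing_setup \<Rightarrow> decision_rule \<Rightarrow> agent list \<Rightarrow> ereal" where
  "welfare_ratio S alg A =
     (if 0 < online_welfare S alg A
      then ereal (offline_welfare S A / online_welfare S alg A)
      else if offline_welfare S A = online_welfare S alg A then 1 else \<infinity>)"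

text \<open>Infinitesimal requirements: the worst-case ratio over the instances with all requirements at
  most \<open>\<epsilon>\<close>, in the limit \<open>\<epsilon> \<rightarrow> 0\<close>. As the supremum is non-decreasing in \<open>\<epsilon>\<close>, the limit is
  an infimum.\<close>

definition competitive_ratio :: "pricing_setup \<Rightarrow> decision_rule \<Rightarrow> ereal" where
  "competitive_ratio S alg = (INF \<epsilon>\<in>{0<..}. SUP A\<in>small_instances S \<epsilon>. welfare_ratio S alg A)"

definition competitive :: "pricing_setup \<Rightarrow> ereal \<Rightarrow> decision_rule \<Rightarrow> bool" where
  "competitive S \<alpha> alg \<longleftrightarrow> online_algorithm S alg \<and> competitive_ratio S alg \<le> \<alpha>"

definition optimal_ratio :: "pricing_setup \<Rightarrow> ereal" where
  "optimal_ratio S = (INF alg\<in>{alg. online_algorithm S alg}. competitive_ratio S alg)"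

text \<open>The arguments of both components are the reports of the earlier agents and the report of
  the current agent.\<close>

record mechanism =
  decision :: decision_rule
  payment :: "agent list \<Rightarrow> agent \<Rightarrow> real"

text \<open>Utility of an agent of true type \<open>\<theta>\<close> who reports \<open>\<theta>'\<close>. An accepted agent receives the
  reported amount of resource, so that her actual request is satisfied only if she did not
  understate her requirement.\<close>

definition utility :: "mechanism \<Rightarrow> agent list \<Rightarrow> agent \<Rightarrow> agent \<Rightarrow> real" where
  "utility M h \<theta> \<theta>' =
     (if decision M h \<theta>' \<and> req \<theta> \<le> req \<theta>' then vln \<theta> else 0) - payment M h \<theta>'"

text \<open>Truthful reporting is optimal whatever the earlier agents reported. Reported valuations are
  not restricted by the price bounds.\<close>

definition incentive_compatible :: "pricing_setup \<Rightarrow> mechanism \<Rightarrow> bool" where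
  "incentive_compatible S M \<longleftrightarrow>
     (\<forall>h \<theta> \<theta>'. (\<forall>\<theta>''\<in>set h. 0 < req \<theta>'') \<longrightarrow> \<theta> \<in> agent_types S \<longrightarrow> 0 < req \<theta>' \<longrightarrow>
        utility M h \<theta> \<theta>' \<le> utility M h \<theta> \<theta>)"

definition pm_accepts :: "(real \<Rightarrow> ereal) \<Rightarrow> real \<Rightarrow> agent \<Rightarrow> bool" where
  "pm_accepts \<phi> y \<theta> \<longleftrightarrow> \<not> (ereal (vln \<theta>) - \<phi> y * ereal (req \<theta>) < 0 \<or> y + req \<theta> > 1)"

definition pm_level :: "(real \<Rightarrow> ereal) \<Rightarrow> agent list \<Rightarrow> real" where
  "pm_level \<phi> h = foldl (\<lambda>y \<theta>. if pm_accepts \<phi> y \<theta> then y + req \<theta> else y) 0 h"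

definition PM :: "(real \<Rightarrow> ereal) \<Rightarrow> mechanism" where
  "PM \<phi> = \<lparr>
     decision = (\<lambda>h \<theta>. pm_accepts \<phi> (pm_level \<phi> h) \<theta>),
     payment = (\<lambda>h \<theta>. if pm_accepts \<phi> (pm_level \<phi> h) \<theta>
                       then real_of_ereal (\<phi> (pm_level \<phi> h)) * req \<theta> else 0)\<rparr>"

text \<open>The class of pricing functions in which uniqueness is claimed. It contains every function
  that equals the lower price bound on \<open>[0,\<omega>)\<close>, is continuous and increasing on \<open>[0,1]\<close>, and is
  infinite beyond the capacity. Prices below the lower bound act exactly like the lower bound and
  are excluded. Left-continuity fixes the values at jumps and at \<open>1\<close>, a price that is
  never charged. Functions on \<open>[0,\<infinity>)\<close> are extensional.\<close>

definition pricing_function :: "pricing_setup \<Rightarrow> (real \<Rightarrow> ereal) \<Rightarrow> bool" where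
  "pricing_function S \<phi> \<longleftrightarrow>
     \<phi> \<in> extensional {0..} \<and>
     mono_on {0..} \<phi> \<and>
     (\<forall>y\<ge>0. ereal (p_lo S) \<le> \<phi> y) \<and>
     (\<forall>y\<in>{0<..1}. continuous (at_left y) \<phi>) \<and>
     (\<forall>y>1. \<phi> y = \<infinity>)"

definition critical_threshold :: "pricing_setup \<Rightarrow> (real \<Rightarrow> ereal) \<Rightarrow> real \<Rightarrow> bool" where
  "critical_threshold S \<phi> \<omega> \<longleftrightarrow>
     \<omega> \<in> {0..1} \<and> (\<forall>y\<in>{0..<\<omega>}. \<phi> y = ereal (p_lo S)) \<and> strict_mono_on {\<omega>..1} \<phi>"

end

theory Submission
  imports Defs "HOL-Real_Asymp.Real_Asymp"
begin

text \<open>Let \<open>P\<close> range over the geometric sequence of margins \<open>v/r - q\<close> from \<open>p_lo - q\<close> to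
  \<open>p_hi - q\<close>, and present for each of them a batch of infinitesimal agents that could fill the
  whole capacity. A \<open>c\<close>-competitive algorithm has welfare at least \<open>P / c\<close> after the batch of margin
  \<open>P\<close>, which in the limit forces its utilization to be at least \<open>(1 + ln (P / (p_lo - q))) / c\<close>.
  At \<open>P = p_hi - q\<close> the capacity \<open>1\<close> gives the lower bound on \<open>c\<close>. If \<open>c\<close> is optimal, all these
  inequalities are tight; this determines the utilization as a function of the price, hence the
  pricing function. Conversely, the optimal price \<open>\<phi>\<close> satisfies
  \<open>\<integral>\<^sub>0\<^sup>y (\<phi> - q) = \<omega> (\<phi>(y) - q)\<close> for \<open>y \<ge> \<omega>\<close>: the revenue is at least \<open>\<omega>\<close> times the
  value \<open>\<phi>(y) - q\<close> of the capacity in the dual bound on the offline welfare.\<close>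

subsection \<open>Online algorithms\<close>

definition online_usage :: "decision_rule \<Rightarrow> agent list \<Rightarrow> real" where
  "online_usage alg A = usage A (accepted alg A)"

definition online_value :: "decision_rule \<Rightarrow> agent list \<Rightarrow> real" where
  "online_value alg A = (\<Sum>n\<in>accepted alg A. vln (A ! n))"

lemma online_welfare_eq: "online_welfare S alg A = online_value alg A - cost S (online_usage alg A)"
  by (simp add: online_welfare_def welfare_def online_value_def online_usage_def)

lemma accepted_Nil [simp]: "accepted alg [] = {}"
  by (simp add: accepted_def)

lemma accepted_subset: "accepted alg A \<subseteq> {..<length A}"
  by (auto simp: accepted_def)

lemma accepted_snoc:
  "accepted alg (A @ [\<theta>]) = (if alg A \<theta> then insert (length A) (accepted alg A) else accepted alg A)"
  by (auto simp: accepted_def nth_append less_Suc_eq)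

lemma sum_accepted_snoc:
  fixes g :: "agent \<Rightarrow> real"
  shows "(\<Sum>n\<in>accepted alg (A @ [\<theta>]). g ((A @ [\<theta>]) ! n))
    = (\<Sum>n\<in>accepted alg A. g (A ! n)) + (if alg A \<theta> then g \<theta> else 0)"
proof -
  have fin: "finite (accepted alg A)" and notin: "length A \<notin> accepted alg A"
    using finite_subset[OF accepted_subset] by (auto simp: accepted_def)
  have "(\<Sum>n\<in>accepted alg A. g ((A @ [\<theta>]) ! n)) = (\<Sum>n\<in>accepted alg A. g (A ! n))"
    by (rule sum.cong) (auto simp: accepted_def nth_append)
  then show ?thesis using fin notin by (simp add: accepted_snoc)
qed

lemma online_usage_Nil [simp]: "online_usage alg [] = 0"
  by (simp add: online_usage_def usage_def)

lemma online_value_Nil [simp]: "online_value alg [] = 0"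
  by (simp add: online_value_def)

lemma online_usage_snoc:
  "online_usage alg (A @ [\<theta>]) = online_usage alg A + (if alg A \<theta> then req \<theta> else 0)"
  unfolding online_usage_def usage_def by (rule sum_accepted_snoc)

lemma online_value_snoc:
  "online_value alg (A @ [\<theta>]) = online_value alg A + (if alg A \<theta> then vln \<theta> else 0)"
  unfolding online_value_def by (rule sum_accepted_snoc)

lemma instances_append [simp]: "A @ B \<in> instances S \<longleftrightarrow> A \<in> instances S \<and> B \<in> instances S"
  by (auto simp: instances_def)

lemma instances_Cons [simp]: "\<theta> # A \<in> instances S \<longleftrightarrow> \<theta> \<in> agent_types S \<and> A \<in> instances S"
  by (auto simp: instances_def)

lemma small_instances_append [simp]:
  "A @ B \<in> small_instances S \<epsilon> \<longleftrightarrow> A \<in> small_instances S \<epsilon> \<and> B \<in> small_instances S \<epsilon>"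
  by (auto simp: small_instances_def)

lemma small_instances_Cons [simp]:
  "\<theta> # A \<in> small_instances S \<epsilon> \<longleftrightarrow> \<theta> \<in> agent_types S \<and> req \<theta> \<le> \<epsilon> \<and> A \<in> small_instances S \<epsilon>"
  by (auto simp: small_instances_def)

lemma online_usage_nonneg: "A \<in> instances S \<Longrightarrow> 0 \<le> online_usage alg A"
  by (induction A rule: rev_induct) (auto simp: online_usage_snoc agent_types_def)

lemma finite_feasible: "finite {welfare S A X |X. X \<subseteq> {..<length A} \<and> usage A X \<le> 1}"
  by (rule finite_subset[of _ "welfare S A ` Pow {..<length A}"]) auto

lemma offline_welfare_ge:
  "X \<subseteq> {..<length A} \<Longrightarrow> usage A X \<le> 1 \<Longrightarrow> welfare S A X \<le> offline_welfare S A"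
  unfolding offline_welfare_def by (rule Max_ge[OF finite_feasible]) auto

lemma offline_welfare_le:
  assumes "\<And>X. X \<subseteq> {..<length A} \<Longrightarrow> usage A X \<le> 1 \<Longrightarrow> welfare S A X \<le> b"
  shows "offline_welfare S A \<le> b"
  unfolding offline_welfare_def
proof (rule Max.boundedI[OF finite_feasible])
  have "usage A {} \<le> 1" by (simp add: usage_def)
  then show "{welfare S A X |X. X \<subseteq> {..<length A} \<and> usage A X \<le> 1} \<noteq> {}" by blast
qed (use assms in auto)

text \<open>If the online welfare is not positive, the hypotheses squeeze both welfares to 0, where
  the ratio counts as 1; hence the requirement \<open>1 \<le> K\<close>.\<close>

lemma welfare_ratio_le:
  assumes "offline_welfare S A \<le> K * online_welfare S alg A" "0 \<le> offline_welfare S A" "1 \<le> K"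
  shows "welfare_ratio S alg A \<le> ereal K"
proof (cases "0 < online_welfare S alg A")
  case True
  then show ?thesis using assms by (simp add: welfare_ratio_def field_simps)
next
  case False
  have "0 \<le> K * online_welfare S alg A" using assms by linarith
  then have "online_welfare S alg A = 0"
    using False assms(3) by (simp add: zero_le_mult_iff)
  then show ?thesis using assms by (simp add: welfare_ratio_def one_ereal_def)
qed

text \<open>The infimum over \<open>\<epsilon>\<close> need not be attained, so a single
  \<open>\<epsilon>\<close> is guaranteed only for \<open>c\<close> strictly above the ratio.
  Arguments at the optimal ratio let \<open>c\<close> decrease to it.\<close>

lemma competitive_ratio_less_imp:
  assumes "competitive_ratio S alg < ereal c"
  obtains \<epsilon> where "0 < \<epsilon>" "\<And>A. A \<in> small_instances S \<epsilon> \<Longrightarrow> welfare_ratio S alg A \<le> ereal c"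
proof -
  obtain \<epsilon> where "0 < \<epsilon>" "(SUP A\<in>small_instances S \<epsilon>. welfare_ratio S alg A) < ereal c"
    using assms unfolding competitive_ratio_def INF_less_iff by auto
  then show ?thesis using that by (meson SUP_upper less_imp_le order_trans)
qed

subsection \<open>Price ladders\<close>

text \<open>The requests fill the capacity exactly, so the offline optimum can live on one batch
  alone; large \<open>M\<close> makes them infinitesimal.\<close>

definition batch :: "nat \<Rightarrow> real \<Rightarrow> agent list" where
  "batch M p = replicate M (1 / real M, p / real M)"

text \<open>Each stage is a prefix of the next. An online algorithm cannot tell where the ladder
  stops, so it must be competitive after every stage.\<close>

fun ladder :: "nat \<Rightarrow> (nat \<Rightarrow> real) \<Rightarrow> nat \<Rightarrow> agent list" where
  "ladder M p 0 = batch M (p 0)"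
| "ladder M p (Suc i) = ladder M p i @ batch M (p (Suc i))"

lemma online_replicate:
  assumes "0 \<le> req \<theta>" "vln \<theta> = p * req \<theta>"
  shows "online_value alg (A @ replicate m \<theta>) - online_value alg A
      = p * (online_usage alg (A @ replicate m \<theta>) - online_usage alg A)"
    and "online_usage alg A \<le> online_usage alg (A @ replicate m \<theta>)"
proof -
  have "online_value alg (A @ replicate m \<theta>) - online_value alg A
      = p * (online_usage alg (A @ replicate m \<theta>) - online_usage alg A) \<and>
    online_usage alg A \<le> online_usage alg (A @ replicate m \<theta>)"
  proof (induction m)
    case (Suc m)
    have "A @ replicate (Suc m) \<theta> = (A @ replicate m \<theta>) @ [\<theta>]"
      by (simp add: replicate_append_same)
    then show ?case using Suc assms
      by (simp only: online_value_snoc online_usage_snoc) (auto simp: algebra_simps)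
  qed simp
  then show "online_value alg (A @ replicate m \<theta>) - online_value alg A
      = p * (online_usage alg (A @ replicate m \<theta>) - online_usage alg A)"
    and "online_usage alg A \<le> online_usage alg (A @ replicate m \<theta>)" by auto
qed

lemma online_batch:
  shows "online_value alg (A @ batch M p) - online_value alg A
      = p * (online_usage alg (A @ batch M p) - online_usage alg A)"
    and "online_usage alg A \<le> online_usage alg (A @ batch M p)"
  using online_replicate[of "(1 / real M, p / real M)" p] by (auto simp: batch_def)

lemma mono_online_usage_ladder: "mono (\<lambda>i. online_usage alg (ladder M p i))"
  by (simp add: incseq_SucI online_batch(2))

lemma batch_small_instance:
  assumes "0 < M" "1 / real M \<le> \<epsilon>" "p_lo S \<le> p" "p \<le> p_hi S"
  shows "batch M p \<in> small_instances S \<epsilon>"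
  using assms by (auto simp: batch_def small_instances_def instances_def agent_types_def)

lemma ladder_small_instance:
  assumes "0 < M" "1 / real M \<le> \<epsilon>" "\<And>j. j \<le> i \<Longrightarrow> p_lo S \<le> p j \<and> p j \<le> p_hi S"
  shows "ladder M p i \<in> small_instances S \<epsilon>"
  using assms(3) by (induction i) (auto intro!: batch_small_instance assms(1,2))

lemma ladder_eq_append_batch: "\<exists>B. ladder M p i = B @ batch M (p i)"
  by (cases i) auto

text \<open>The quantity \<open>J i = Y i - W i / P i\<close>, where \<open>P i\<close> is the geometric sequence of marginal
  profits, satisfies the recursion \<open>J (i + 1) = J i + \<kappa> * (Y i - J i)\<close> and thus grows by at least
  \<open>\<kappa> / c\<close> in each step.\<close>

lemma ladder_recursion:
  fixes Y W :: "nat \<Rightarrow> real" and a c h :: real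
  assumes W0: "W 0 = a * Y 0"
    and W: "\<And>i. W (Suc i) = W i + a * exp (h * real (Suc i)) * (Y (Suc i) - Y i)"
    and ge: "\<And>i. i \<le> k \<Longrightarrow> a * exp (h * real i) / c \<le> W i"
    and a: "0 < a" and c: "0 < c" and h: "0 \<le> h"
  defines "\<kappa> \<equiv> 1 - exp (- h)"
  shows "\<And>i. i \<le> k \<Longrightarrow> (1 + real i * \<kappa>) / c \<le> Y i"
    and "\<And>i m. i + m \<le> k \<Longrightarrow> mono Y \<Longrightarrow> Y k \<le> 1 \<Longrightarrow>
      real m * \<kappa> * (Y i - (1 - (1 + (real k - real i - real m) * \<kappa>) / c))
        \<le> 1 - (1 + (real k - real m) * \<kappa>) / c"
proof -
  define J where "J i = Y i - W i / (a * exp (h * real i))" for i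
  have \<kappa>: "0 \<le> \<kappa>" using h by (simp add: \<kappa>_def)
  have J0: "J 0 = 0" using a W0 by (simp add: J_def)
  \<comment> \<open>The new batch adds \<open>Y (Suc i) - Y i\<close> both to \<open>Y\<close> and
    to \<open>W / P\<close>, so it cancels in \<open>J\<close>; only the deflation of the old
    welfare by \<open>exp (- h)\<close> remains.\<close>
  have JS: "J (Suc i) = J i + \<kappa> * (Y i - J i)" for i
  proof -
    define E where "E = exp (h * real i)"
    have E: "exp (h * real (Suc i)) = exp h * E"
      unfolding E_def exp_add[symmetric] by (simp add: algebra_simps)
    have "J (Suc i) = Y (Suc i) - (W i + a * (exp h * E) * (Y (Suc i) - Y i)) / (a * (exp h * E))"
      unfolding J_def W E ..
    also have "\<dots> = Y i - W i / (a * (exp h * E))"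
      using a by (simp add: add_divide_distrib E_def)
    also have "\<dots> = J i + \<kappa> * (Y i - J i)"
      using a unfolding J_def \<kappa>_def E_def[symmetric] exp_minus
      by (simp add: E_def field_simps)
    finally show ?thesis .
  qed
  have gap: "1 / c \<le> Y i - J i" if "i \<le> k" for i
    using ge[OF that] a c by (simp add: J_def field_simps)
  have step: "J i + \<kappa> / c \<le> J (Suc i)" if "i \<le> k" for i
    using mult_left_mono[OF gap[OF that] \<kappa>] by (simp add: JS)
  have steps: "J i + real n * \<kappa> / c \<le> J (i + n)" if "i + n \<le> k" for i n
    using that
  proof (induction n)
    case (Suc n)
    then show ?case using step[of "i + n"] by (auto simp: add_divide_distrib algebra_simps)
  qed simp
  show ge': "(1 + real i * \<kappa>) / c \<le> Y i" if "i \<le> k" for i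
    using steps[of 0 i] gap[of i] that J0 by (simp add: add_divide_distrib)
  show "real m * \<kappa> * (Y i - (1 - (1 + (real k - real i - real m) * \<kappa>) / c))
        \<le> 1 - (1 + (real k - real m) * \<kappa>) / c"
    if im: "i + m \<le> k" and "mono Y" "Y k \<le> 1" for i m
  proof -
    \<comment> \<open>The capacity caps \<open>J k\<close>; the growth guaranteed in the remaining
      steps then caps \<open>J (i + m)\<close>.\<close>
    have "J k \<le> 1 - 1 / c" using gap[of k] that by auto
    then have Jim: "J (i + m) \<le> 1 - (1 + (real k - real i - real m) * \<kappa>) / c"
      using steps[of "i + m" "k - (i + m)"] im
      by (simp add: add_divide_distrib diff_divide_distrib of_nat_diff algebra_simps)
    have Ji: "real i * \<kappa> / c \<le> J i" using steps[of 0 i] im J0 by simp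
    have Jmono: "J j \<le> J (i + m)" if "j \<le> i + m" for j
    proof -
      have "0 \<le> real (i + m - j) * \<kappa> / c" using \<kappa> c by simp
      then show ?thesis using steps[of j "i + m - j"] that im by simp
    qed
    \<comment> \<open>During these steps \<open>Y\<close> is at least \<open>Y i\<close> and
      \<open>J\<close> at most \<open>J (i + m)\<close>, so a large usage at \<open>i\<close> makes
      \<open>J\<close> climb fast. The room between the floor \<open>Ji\<close> and the cap
      \<open>Jim\<close> thus bounds \<open>Y i\<close> from above.\<close>
    have "real n * (\<kappa> * (Y i - J (i + m))) \<le> J (i + n) - J i" if "n \<le> m" for n
      using that
    proof (induction n)
      case (Suc n)
      have "Y i - J (i + m) \<le> Y (i + n) - J (i + n)"
        using monoD[OF \<open>mono Y\<close>, of i "i + n"] Jmono[of "i + n"] Suc.prems by simp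
      from mult_left_mono[OF this \<kappa>] show ?case
        using Suc by (simp add: JS algebra_simps)
    qed simp
    from this[of m] have "real m * \<kappa> * (Y i - J (i + m)) \<le> J (i + m) - J i"
      by (simp add: mult.assoc)
    moreover have "real m * \<kappa> * (Y i - (1 - (1 + (real k - real i - real m) * \<kappa>) / c))
        \<le> real m * \<kappa> * (Y i - J (i + m))"
      using Jim \<kappa> by (intro mult_left_mono) auto
    moreover have "J (i + m) - J i \<le> 1 - (1 + (real k - real m) * \<kappa>) / c"
      using Jim Ji c by (simp add: field_simps)
    ultimately show ?thesis by linarith
  qed
qed

subsection \<open>Posted price mechanisms\<close>

lemma decision_PM: "decision (PM \<phi>) h \<theta> \<longleftrightarrow> pm_accepts \<phi> (pm_level \<phi> h) \<theta>"
  by (simp add: PM_def)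

lemma pm_level_Nil [simp]: "pm_level \<phi> [] = 0"
  by (simp add: pm_level_def)

lemma pm_level_snoc:
  "pm_level \<phi> (A @ [\<theta>])
    = (if pm_accepts \<phi> (pm_level \<phi> A) \<theta> then pm_level \<phi> A + req \<theta> else pm_level \<phi> A)"
  by (simp add: pm_level_def)

lemma online_usage_PM: "online_usage (decision (PM \<phi>)) A = pm_level \<phi> A"
  by (induction A rule: rev_induct) (auto simp: online_usage_snoc pm_level_snoc decision_PM)

lemma pm_level_le_1: "pm_level \<phi> A \<le> 1"
  by (induction A rule: rev_induct) (auto simp: pm_level_snoc pm_accepts_def)

lemma pm_level_nonneg: "\<forall>\<theta>\<in>set A. 0 < req \<theta> \<Longrightarrow> 0 \<le> pm_level \<phi> A"
  by (induction A rule: rev_induct) (auto simp: pm_level_snoc)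

lemma online_algorithm_PM: "online_algorithm S (decision (PM \<phi>))"
  unfolding online_algorithm_def
  by (metis online_usage_PM online_usage_def pm_level_le_1)

lemma pm_accepts_iff:
  "\<phi> y = ereal x \<Longrightarrow> pm_accepts \<phi> y \<theta> \<longleftrightarrow> x * req \<theta> \<le> vln \<theta> \<and> y + req \<theta> \<le> 1"
  by (auto simp: pm_accepts_def)

lemma pm_accepts_infinity: "\<phi> y = \<infinity> \<Longrightarrow> 0 < req \<theta> \<Longrightarrow> \<not> pm_accepts \<phi> y \<theta>"
  by (auto simp: pm_accepts_def)

lemma pm_accepts_price_le:
  assumes "pm_accepts \<phi> y \<theta>" "0 < req \<theta>" "vln \<theta> \<le> p * req \<theta>"
  shows "\<phi> y \<le> ereal p"
proof (cases "\<phi> y")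
  case (real x)
  then have "x * req \<theta> \<le> vln \<theta>" using assms by (simp add: pm_accepts_iff)
  also note assms(3)
  finally have "x * req \<theta> \<le> p * req \<theta>" .
  then have "x \<le> p" using assms(2) by (rule mult_right_le_imp_le)
  then show ?thesis using real by simp
qed (use assms pm_accepts_infinity in auto)

lemma pm_accepts_if_price_le:
  assumes "\<phi> y \<le> ereal p" "\<phi> y \<noteq> -\<infinity>" "0 < req \<theta>" "p * req \<theta> \<le> vln \<theta>" "y + req \<theta> \<le> 1"
  shows "pm_accepts \<phi> y \<theta>"
proof (cases "\<phi> y")
  case (real x)
  then have "x * req \<theta> \<le> p * req \<theta>" using assms by (intro mult_right_mono) auto
  also note assms(4)
  finally have "x * req \<theta> \<le> vln \<theta>" .
  then show ?thesis using assms by (auto simp: pm_accepts_iff[of \<phi> y x, OF real])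
qed (use assms in auto)

text \<open>Once the level reaches \<open>y\<close>, the price exceeds every offered unit price. The
  last acceptance happens below \<open>y\<close> and overshoots it by at most
  \<open>r\<close>.\<close>

lemma pm_level_le:
  assumes mono: "mono_on {0..} \<phi>" and y: "0 \<le> y" "ereal p < \<phi> y" and r: "0 \<le> r"
    and A: "\<forall>\<theta>\<in>set A. 0 < req \<theta> \<and> req \<theta> \<le> r \<and> vln \<theta> \<le> p * req \<theta>"
  shows "pm_level \<phi> A \<le> y + r"
  using A
proof (induction A rule: rev_induct)
  case (snoc \<theta> A)
  have lev: "0 \<le> pm_level \<phi> A" using snoc.prems by (intro pm_level_nonneg) auto
  have "pm_level \<phi> A < y" if "pm_accepts \<phi> (pm_level \<phi> A) \<theta>"
  proof (rule ccontr)
    assume "\<not> ?thesis"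
    then have "\<phi> y \<le> \<phi> (pm_level \<phi> A)" using y lev by (intro mono_onD[OF mono]) auto
    also have "\<dots> \<le> ereal p" using that snoc.prems by (intro pm_accepts_price_le) auto
    finally show False using y by simp
  qed
  then show ?case using snoc by (auto simp: pm_level_snoc)
qed (use y r in simp)

text \<open>As long as the level is more than \<open>1 / M\<close> below \<open>y\<close>, the price
  is at most \<open>p\<close> and the capacity suffices, so the next agent of the batch is accepted;
  \<open>M\<close> agents are enough to get there.\<close>

lemma pm_level_batch_ge:
  assumes mono: "mono_on {0..} \<phi>" and fin: "\<And>z. 0 \<le> z \<Longrightarrow> \<phi> z \<noteq> -\<infinity>"
    and y: "0 \<le> y" "y \<le> 1" "\<phi> y \<le> ereal p" and M: "0 < M"
    and A: "\<forall>\<theta>\<in>set A. 0 < req \<theta>"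
  shows "y - 1 / real M \<le> pm_level \<phi> (A @ batch M p)"
proof -
  let ?\<theta> = "(1 / real M, p / real M)"
  let ?lev = "\<lambda>m. pm_level \<phi> (A @ replicate m ?\<theta>)"
  have lev: "0 \<le> ?lev m" for m using A M by (intro pm_level_nonneg) auto
  \<comment> \<open>Either the target is reached already, or each of the first \<open>m\<close>
    agents has contributed \<open>1 / M\<close>. At \<open>m = M\<close> the second argument is 1
    and the minimum is the target.\<close>
  have "min (y - 1 / real M) (real m / real M) \<le> ?lev m" for m
  proof (induction m)
    case 0
    show ?case using lev[of 0] by simp
  next
    case (Suc m)
    have "A @ replicate (Suc m) ?\<theta> = (A @ replicate m ?\<theta>) @ [?\<theta>]"
      by (simp add: replicate_append_same)
    then have step: "?lev (Suc m)
        = (if pm_accepts \<phi> (?lev m) ?\<theta> then ?lev m + 1 / real M else ?lev m)"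
      by (simp only: pm_level_snoc) simp
    show ?case
    proof (cases "?lev m < y - 1 / real M")
      case True
      have "?lev m \<le> y" using True M by (smt (verit) divide_nonneg_nonneg of_nat_0_le_iff)
      then have "\<phi> (?lev m) \<le> ereal p"
        using mono_onD[OF mono, of "?lev m" y] lev y by (auto intro: order_trans)
      then have "pm_accepts \<phi> (?lev m) ?\<theta>"
        using True y M fin[OF lev] by (intro pm_accepts_if_price_le[where p = p]) auto
      then show ?thesis using Suc True step by (simp add: add_divide_distrib)
    next
      case False
      have "?lev m \<le> ?lev (Suc m)" unfolding step by simp
      then show ?thesis using False by linarith
    qed
  qed
  moreover have "y - 1 / real M \<le> 1" using y by (smt (verit) divide_nonneg_nonneg of_nat_0_le_iff)
  ultimately show ?thesis using M by (metis batch_def divide_self min.absorb1 of_nat_0_less_iff less_irrefl)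
qed

text \<open>The unit price depends on earlier reports only. Understating the requirement forfeits
  the request; overstating it cannot help with the capacity and, the price being non-negative, never
  lowers the payment. A false valuation only changes acceptance, and truth accepts exactly when this
  is affordable.\<close>

lemma incentive_compatible_PM:
  assumes price: "\<And>y. 0 \<le> y \<Longrightarrow> 0 \<le> \<phi> y"
  shows "incentive_compatible S (PM \<phi>)"
  unfolding incentive_compatible_def
proof (intro allI impI)
  fix h and \<theta> \<theta>' :: agent
  assume h: "\<forall>\<theta>''\<in>set h. 0 < req \<theta>''" and \<theta>: "\<theta> \<in> agent_types S" and \<theta>': "0 < req \<theta>'"
  define y where "y = pm_level \<phi> h"
  have r: "0 < req \<theta>" using \<theta> by (simp add: agent_types_def)
  have "0 \<le> \<phi> y" unfolding y_def by (intro price pm_level_nonneg h)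
  then consider x where "\<phi> y = ereal x" "0 \<le> x" | "\<phi> y = \<infinity>" by (cases "\<phi> y") auto
  then show "utility (PM \<phi>) h \<theta> \<theta>' \<le> utility (PM \<phi>) h \<theta> \<theta>"
  proof cases
    case 1
    have "x * req \<theta> \<le> x * req \<theta>'" if "req \<theta> \<le> req \<theta>'" using that 1 by (intro mult_left_mono)
    moreover have "0 \<le> x * req \<theta>'" using 1 \<theta>' by simp
    ultimately show ?thesis using 1
      by (auto simp: utility_def PM_def y_def[symmetric] pm_accepts_iff)
  next
    case 2
    then show ?thesis using r \<theta>'
      by (simp add: utility_def PM_def y_def[symmetric] pm_accepts_infinity)
  qed
qed

subsection \<open>Linear cost\<close>

locale linear_setup =
  fixes S :: pricing_setup and q :: real
  assumes q_nonneg: "0 \<le> q" and q_less: "q < p_lo S" and p_lo_le: "p_lo S \<le> p_hi S"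
    and cost_linear: "\<And>y. 0 \<le> y \<Longrightarrow> y \<le> 1 \<Longrightarrow> cost S y = q * y"
begin

lemma online_welfare_linear:
  assumes "online_algorithm S alg" "A \<in> instances S"
  shows "online_welfare S alg A = online_value alg A - q * online_usage alg A"
  using assms online_usage_nonneg[of A S alg]
  by (simp add: online_welfare_eq cost_linear online_algorithm_def online_usage_def)

text \<open>The witness accepts exactly the last batch, whatever came before.\<close>

lemma offline_welfare_batch:
  assumes "0 < M"
  shows "p - q \<le> offline_welfare S (B @ batch M p)"
proof -
  let ?A = "B @ batch M p" and ?X = "{length B..<length B + M}"
  have len: "length ?A = length B + M" by (simp add: batch_def)
  have nth: "?A ! n = (1 / real M, p / real M)" if "n \<in> ?X" for n
    using that by (auto simp: batch_def nth_append)
  have us: "usage ?A ?X = 1" using assms by (simp add: usage_def nth)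
  have "welfare S ?A ?X = p - q"
    using assms by (simp add: welfare_def us cost_linear nth)
  moreover have "welfare S ?A ?X \<le> offline_welfare S ?A"
    by (rule offline_welfare_ge) (auto simp: len[unfolded length_append] us)
  ultimately show ?thesis by simp
qed

text \<open>With \<open>W\<close> the welfare net of cost, a batch of price \<open>p j\<close>
  changes \<open>W\<close> by the margin \<open>p j - q\<close> times the usage gained, which is the
  setting of \<open>ladder_recursion\<close>.\<close>

lemma ladder_bounds:
  fixes alg :: decision_rule and c \<epsilon> h :: real and k M :: nat
  assumes alg: "online_algorithm S alg"
    and ratio: "\<And>A. A \<in> small_instances S \<epsilon> \<Longrightarrow> welfare_ratio S alg A \<le> ereal c"
    and M: "0 < M" "1 / real M \<le> \<epsilon>" and h: "0 \<le> h"
    and top: "(p_lo S - q) * exp (h * real k) \<le> p_hi S - q"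
  defines "Y \<equiv> \<lambda>i. online_usage alg (ladder M (\<lambda>j. q + (p_lo S - q) * exp (h * real j)) i)"
    and "\<kappa> \<equiv> 1 - exp (- h)"
  shows "0 < c" and "\<And>i. i \<le> k \<Longrightarrow> (1 + real i * \<kappa>) / c \<le> Y i" and "Y k \<le> 1"
    and "\<And>i m. i + m \<le> k \<Longrightarrow>
      real m * \<kappa> * (Y i - (1 - (1 + (real k - real i - real m) * \<kappa>) / c))
        \<le> 1 - (1 + (real k - real m) * \<kappa>) / c"
proof -
  define p where "p = (\<lambda>j. q + (p_lo S - q) * exp (h * real j))"
  define W where "W i = online_value alg (ladder M p i) - q * Y i" for i
  have Y: "Y i = online_usage alg (ladder M p i)" for i by (simp add: Y_def p_def)
  have a: "0 < p_lo S - q" using q_less by simp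
  have p_bounds: "p_lo S \<le> p j \<and> p j \<le> p_hi S" if "j \<le> k" for j
  proof -
    have "h * real j \<le> h * real k" using h that by (intro mult_left_mono) auto
    then have "(p_lo S - q) * exp (h * real j) \<le> (p_lo S - q) * exp (h * real k)"
      using a by simp
    moreover have "(p_lo S - q) * 1 \<le> (p_lo S - q) * exp (h * real j)"
      using a h by (intro mult_left_mono) auto
    ultimately show ?thesis using top by (auto simp: p_def)
  qed
  have small: "ladder M p i \<in> small_instances S \<epsilon>" if "i \<le> k" for i
    using M p_bounds that by (intro ladder_small_instance) auto
  have inst: "ladder M p i \<in> instances S" if "i \<le> k" for i
    using small[OF that] by (simp add: small_instances_def)
  have Y_le: "Y i \<le> 1" if "i \<le> k" for i
    using alg inst[OF that] by (simp add: Y online_algorithm_def online_usage_def)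
  \<comment> \<open>The offline welfare is positive, so a non-positive \<open>W i\<close> would make
    the ratio infinite.\<close>
  have pos: "0 < W i \<and> (p i - q) / W i \<le> c" if "i \<le> k" for i
  proof -
    let ?A = "ladder M p i"
    have W_eq: "online_welfare S alg ?A = W i"
      by (simp add: W_def Y online_welfare_linear[OF alg inst[OF that]])
    obtain B where "?A = B @ batch M (p i)" using ladder_eq_append_batch by blast
    then have off: "p i - q \<le> offline_welfare S ?A"
      using offline_welfare_batch[OF M(1), of "p i" B] by simp
    have r: "welfare_ratio S alg ?A \<le> ereal c" using ratio small[OF that] by blast
    have "0 < offline_welfare S ?A" using off p_bounds[OF that] q_less by linarith
    then have W_pos: "0 < W i" using r by (auto simp: welfare_ratio_def W_eq split: if_splits)
    then have "offline_welfare S ?A / W i \<le> c" using r by (simp add: welfare_ratio_def W_eq)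
    moreover have "(p i - q) / W i \<le> offline_welfare S ?A / W i"
      using off W_pos by (simp add: divide_right_mono)
    ultimately show ?thesis using W_pos by linarith
  qed
  have "0 < (p 0 - q) / W 0" using pos[of 0] a by (simp add: p_def)
  then show c: "0 < c" using pos[of 0] by linarith
  have W0: "W 0 = (p_lo S - q) * Y 0"
    using online_batch(1)[of alg "[]" M "p 0"] by (simp add: W_def Y p_def algebra_simps)
  have WS: "W (Suc i) = W i + (p_lo S - q) * exp (h * real (Suc i)) * (Y (Suc i) - Y i)" for i
    using online_batch(1)[of alg "ladder M p i" M "p (Suc i)"]
    by (simp add: W_def Y) (simp add: p_def algebra_simps)
  have ge: "(p_lo S - q) * exp (h * real i) / c \<le> W i" if "i \<le> k" for i
    using pos[OF that] c by (auto simp: p_def pos_divide_le_eq mult.commute)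
  have "mono Y" unfolding Y_def by (rule mono_online_usage_ladder)
  note rec = ladder_recursion[OF W0 WS ge a c h, of k, folded \<kappa>_def]
  show "(1 + real i * \<kappa>) / c \<le> Y i" if "i \<le> k" for i using rec(1)[OF _ that] by blast
  show "Y k \<le> 1" using Y_le by blast
  show "real m * \<kappa> * (Y i - (1 - (1 + (real k - real i - real m) * \<kappa>) / c))
        \<le> 1 - (1 + (real k - real m) * \<kappa>) / c" if "i + m \<le> k" for i m
    using rec(2)[OF _ that \<open>mono Y\<close>] Y_le by blast
qed

text \<open>The bound on the requirements turns into a condition on large \<open>M\<close>, so that
  limits in \<open>M\<close> can be taken while \<open>c\<close>, \<open>h\<close> and
  \<open>k\<close> stay fixed.\<close>

lemma ladder_bounds_small:
  assumes alg: "online_algorithm S alg" and ratio: "competitive_ratio S alg < ereal c"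
    and h: "0 \<le> h" and top: "(p_lo S - q) * exp (h * real k) \<le> p_hi S - q"
  defines "Y \<equiv> \<lambda>M i. online_usage alg (ladder M (\<lambda>j. q + (p_lo S - q) * exp (h * real j)) i)"
    and "\<kappa> \<equiv> 1 - exp (- h)"
  shows "0 < c"
    and "i \<le> k \<Longrightarrow> \<forall>\<^sub>F M in sequentially. (1 + real i * \<kappa>) / c \<le> Y M i \<and> Y M i \<le> 1"
    and "i + m \<le> k \<Longrightarrow> \<forall>\<^sub>F M in sequentially.
      real m * \<kappa> * (Y M i - (1 - (1 + (real k - real i - real m) * \<kappa>) / c))
        \<le> 1 - (1 + (real k - real m) * \<kappa>) / c"
proof -
  obtain \<epsilon> where \<epsilon>: "0 < \<epsilon>"
    and r: "\<And>A. A \<in> small_instances S \<epsilon> \<Longrightarrow> welfare_ratio S alg A \<le> ereal c"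
    using competitive_ratio_less_imp[OF ratio] by blast
  have "(\<lambda>M. 1 / real M) \<longlonglongrightarrow> 0" by real_asymp
  then have ev: "\<forall>\<^sub>F M in sequentially. 0 < M \<and> 1 / real M \<le> \<epsilon>"
    by (intro eventually_conj eventually_gt_at_top eventually_mono[OF order_tendstoD(2)[OF _ \<epsilon>]])
      auto
  then obtain M where "0 < M \<and> 1 / real M \<le> \<epsilon>"
    using eventually_happens'[OF sequentially_bot] by blast
  then show "0 < c" using ladder_bounds(1)[OF alg r _ _ h top] by blast
  show "\<forall>\<^sub>F M in sequentially. (1 + real i * \<kappa>) / c \<le> Y M i \<and> Y M i \<le> 1" if "i \<le> k"
    using ev
  proof eventually_elim
    case (elim M)
    have "Y M i \<le> Y M k" unfolding Y_def by (rule monoD[OF mono_online_usage_ladder that])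
    then show ?case unfolding Y_def \<kappa>_def
      using ladder_bounds(2)[OF alg r _ _ h top that] ladder_bounds(3)[OF alg r _ _ h top] elim
      by (meson order_trans)
  qed
  show "\<forall>\<^sub>F M in sequentially.
      real m * \<kappa> * (Y M i - (1 - (1 + (real k - real i - real m) * \<kappa>) / c))
        \<le> 1 - (1 + (real k - real m) * \<kappa>) / c" if "i + m \<le> k"
    using ev
  proof eventually_elim
    case (elim M)
    then show ?case unfolding Y_def \<kappa>_def
      using ladder_bounds(4)[OF alg r _ _ h top that] by blast
  qed
qed

section \<open>Lower bound on the competitive ratio\<close>

definition opt_ratio :: real where
  "opt_ratio = 1 + ln ((p_hi S - q) / (p_lo S - q))"

lemma opt_ratio_ge_1: "1 \<le> opt_ratio"
  using q_less p_lo_le by (simp add: opt_ratio_def)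

lemma exp_opt_ratio: "(p_lo S - q) * exp (opt_ratio - 1) = p_hi S - q"
  using q_less p_lo_le by (simp add: opt_ratio_def)

text \<open>\<open>h * k\<close> is the total logarithmic rise of the margin, and
  \<open>opt_ratio - 1\<close> the logarithmic width of the whole range of margins.\<close>

lemma ladder_top:
  assumes "h * real k \<le> opt_ratio - 1"
  shows "(p_lo S - q) * exp (h * real k) \<le> p_hi S - q"
proof -
  have "(p_lo S - q) * exp (h * real k) \<le> (p_lo S - q) * exp (opt_ratio - 1)"
    using assms q_less by (intro mult_left_mono) auto
  then show ?thesis by (simp only: exp_opt_ratio)
qed

text \<open>Refining a rise of \<open>t\<close> into \<open>n\<close> steps turns the discrete usage
  bound into the continuous one, \<open>(1 + t) / c\<close>.\<close>

lemma ladder_limit: "(\<lambda>n. 1 + real n * (1 - exp (- (t / real n)))) \<longlonglongrightarrow> 1 + t"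
  by real_asymp

text \<open>A ladder over the full range of margins needs usage of about
  \<open>opt_ratio / c\<close>, which exceeds the capacity if \<open>c < opt_ratio\<close>.\<close>

lemma competitive_ratio_ge:
  assumes alg: "online_algorithm S alg"
  shows "ereal opt_ratio \<le> competitive_ratio S alg"
proof (rule ccontr)
  assume "\<not> ?thesis"
  then have "competitive_ratio S alg < ereal opt_ratio" by simp
  from ereal_dense2[OF this]
  obtain c where c: "competitive_ratio S alg < ereal c" "c < opt_ratio" by auto
  have "\<forall>\<^sub>F n in sequentially. 1 + real n * (1 - exp (- ((opt_ratio - 1) / real n))) \<le> c"
    using eventually_gt_at_top[of 0]
  proof eventually_elim
    case (elim n)
    define h where "h = (opt_ratio - 1) / real n"
    have h: "0 \<le> h" "h * real n \<le> opt_ratio - 1"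
      using elim opt_ratio_ge_1 by (auto simp: h_def)
    note b = ladder_bounds_small[OF alg c(1) h(1) ladder_top[OF h(2)]]
    have "(1 + real n * (1 - exp (- h))) / c \<le> 1"
      using eventually_happens'[OF sequentially_bot b(2)[of n]] by auto
    then show ?case using b(1) by (simp add: h_def)
  qed
  from tendsto_upperbound[OF ladder_limit this] have "opt_ratio \<le> c" by simp
  with c show False by simp
qed

section \<open>Prices forced by optimality\<close>

text \<open>A price exceeding this bound would make the ladder leave too much capacity unused. In the
  converse lemma below, a price that is too low would let the capacity run out.\<close>

lemma optimal_price_le:
  assumes \<phi>: "pricing_function S \<phi>"
    and ratio: "competitive_ratio S (decision (PM \<phi>)) \<le> ereal opt_ratio"
    and t: "0 \<le> t" "t \<le> opt_ratio - 1" and y: "0 \<le> y" "opt_ratio * y < 1 + t"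
  shows "\<phi> y \<le> ereal (q + (p_lo S - q) * exp t)"
proof (rule ccontr)
  assume "\<not> ?thesis"
  then have high: "ereal (q + (p_lo S - q) * exp t) < \<phi> y" by simp
  have mono: "mono_on {0..} \<phi>" using \<phi> by (simp add: pricing_function_def)
  let ?K = "\<lambda>n. 1 + real n * (1 - exp (- (t / real n)))"
  \<comment> \<open>All ladder prices stay below \<open>\<phi> y\<close>, so the final level is at
    most \<open>1 / M\<close> above \<open>y\<close>, while competitiveness demands at least
    \<open>?K n / c\<close>.\<close>
  have c_bound: "?K n \<le> c * y" if n: "0 < n" and c: "opt_ratio < c" for n c
  proof -
    define h where "h = t / real n"
    have h: "0 \<le> h" "h * real n = t" using n t by (auto simp: h_def)
    have "competitive_ratio S (decision (PM \<phi>)) < ereal c"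
      using ratio c by (simp add: le_less_trans)
    note b = ladder_bounds_small[OF online_algorithm_PM this h(1) ladder_top[of h n]]
    have top: "h * real n \<le> opt_ratio - 1" using h t by simp
    have "\<forall>\<^sub>F M in sequentially. ?K n / c \<le> y + 1 / real M"
      using b(2)[OF top order.refl] eventually_gt_at_top[of 0]
    proof eventually_elim
      case (elim M)
      let ?p = "\<lambda>j. q + (p_lo S - q) * exp (h * real j)"
      have lad: "\<forall>\<theta>\<in>set (ladder M ?p i). 0 < req \<theta> \<and> req \<theta> \<le> 1 / real M \<and>
          vln \<theta> \<le> (q + (p_lo S - q) * exp t) * req \<theta>" if "i \<le> n" for i
        using that
      proof (induction i)
        case 0
        have "p_lo S - q \<le> (p_lo S - q) * exp t" using q_less t by simp
        then show ?case using elim by (auto simp: batch_def divide_right_mono)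
      next
        case (Suc i)
        have "h * real (Suc i) \<le> h * real n" using Suc.prems h by (intro mult_left_mono) auto
        then have "?p (Suc i) \<le> q + (p_lo S - q) * exp t" using h q_less by simp
        then show ?case using Suc elim by (auto simp: batch_def divide_right_mono)
      qed
      have "pm_level \<phi> (ladder M ?p n) \<le> y + 1 / real M"
        by (rule pm_level_le[OF mono y(1) high _ lad]) auto
      then show ?case using elim by (simp add: online_usage_PM h_def)
    qed
    moreover have "(\<lambda>M. y + 1 / real M) \<longlonglongrightarrow> y" by real_asymp
    ultimately have "?K n / c \<le> y" by (intro tendsto_lowerbound) auto
    then show ?thesis using b(1)[OF top] by (simp add: pos_divide_le_eq mult.commute)
  qed
  \<comment> \<open>The limits come in the order \<open>M\<close>, \<open>c\<close>,
    \<open>n\<close>: the ladder bounds need \<open>c\<close> strictly above the ratio, and only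
    afterwards is the ladder refined.\<close>
  have "?K n \<le> opt_ratio * y" if "0 < n" for n
  proof (rule tendsto_lowerbound)
    show "((\<lambda>c. c * y) \<longlongrightarrow> opt_ratio * y) (at_right opt_ratio)" by (intro tendsto_intros)
    show "\<forall>\<^sub>F c in at_right opt_ratio. ?K n \<le> c * y"
      unfolding eventually_at_filter using c_bound that by (auto intro!: always_eventually)
  qed simp
  then have "\<forall>\<^sub>F n in sequentially. ?K n \<le> opt_ratio * y"
    by (rule eventually_mono[OF eventually_gt_at_top])
  then have "1 + t \<le> opt_ratio * y"
    by (rule tendsto_upperbound[OF ladder_limit _ sequentially_bot])
  with y show False by simp
qed

lemma optimal_price_ge:
  assumes \<phi>: "pricing_function S \<phi>"
    and ratio: "competitive_ratio S (decision (PM \<phi>)) \<le> ereal opt_ratio"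
    and t: "0 \<le> t" "t < opt_ratio - 1" and y: "0 \<le> y" "y \<le> 1"
    and low: "\<phi> y \<le> ereal (q + (p_lo S - q) * exp t)"
  shows "opt_ratio * y \<le> 1 + t"
proof -
  define s where "s = opt_ratio - 1"
  have s: "0 < s" "t < s" using t by (auto simp: s_def)
  have mono: "mono_on {0..} \<phi>" and fin: "\<And>z. 0 \<le> z \<Longrightarrow> \<phi> z \<noteq> -\<infinity>"
    using \<phi> by (auto simp: pricing_function_def)
  \<comment> \<open>The logarithmic range \<open>s\<close> is cut into \<open>b\<close> blocks of
    \<open>n\<close> ladder steps. After \<open>a\<close> blocks the ladder price is at least
    \<open>\<phi> y\<close>; the upper bound on usage is applied there with \<open>i = a * n\<close>
    and one further block, \<open>m = n\<close>, which exists because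
    \<open>a + 1 \<le> b\<close>.\<close>
  have bound: "opt_ratio * y \<le> 1 + (real a + 1) * (s / real b)"
    if ab: "a + 1 \<le> b" and at: "t \<le> s * real a / real b" for a b :: nat
  proof -
    have b: "0 < b" using ab by simp
    define \<kappa> where "\<kappa> n = real n * (1 - exp (- (s / real b / real n)))" for n
    have \<kappa>_lim: "\<kappa> \<longlonglongrightarrow> s / real b"
      unfolding \<kappa>_def by real_asymp
    let ?L = "\<lambda>c k. k * (y - (1 - (1 + (real b - real a - 1) * k) / c))"
    let ?R = "\<lambda>c k. 1 - (1 + (real b - 1) * k) / c"
    have c_bound: "?L c (\<kappa> n) \<le> ?R c (\<kappa> n)" if n: "0 < n" and c: "opt_ratio < c" for n c
    proof -
      define h where "h = s / real b / real n"
      have h: "0 \<le> h" "h * real (b * n) = s" using n b s by (auto simp: h_def)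
      have "competitive_ratio S (decision (PM \<phi>)) < ereal c"
        using ratio c by (simp add: le_less_trans)
      note bd = ladder_bounds_small(3)[OF online_algorithm_PM this h(1) ladder_top[of h "b * n"]]
      have top: "h * real (b * n) \<le> opt_ratio - 1" using h by (simp add: s_def)
      have ind: "a * n + n \<le> b * n" using mult_right_mono[OF ab, of n] by simp
      have \<kappa>: "\<kappa> n = real n * (1 - exp (- h))" by (simp add: \<kappa>_def h_def)
      have \<kappa>_nonneg: "0 \<le> \<kappa> n" using h by (simp add: \<kappa>)
      have "\<forall>\<^sub>F M in sequentially.
          \<kappa> n * (y - 1 / real M - (1 - (1 + (real b - real a - 1) * \<kappa> n) / c)) \<le> ?R c (\<kappa> n)"
        using bd[OF top ind] eventually_gt_at_top[of 0]
      proof eventually_elim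
        case (elim M)
        let ?p = "\<lambda>j. q + (p_lo S - q) * exp (h * real j)"
        have "h * real (a * n) = s * real a / real b" using n by (simp add: h_def)
        then have "q + (p_lo S - q) * exp t \<le> ?p (a * n)" using at q_less by simp
        then have low': "\<phi> y \<le> ereal (?p (a * n))" using low by (meson ereal_less_eq(3) order_trans)
        obtain B where B: "ladder M ?p (a * n) = B @ batch M (?p (a * n))"
          using ladder_eq_append_batch[of M ?p "a * n"] by blast
        have pos: "\<forall>\<theta>\<in>set (ladder M ?p i). 0 < req \<theta>" for i
          using elim by (induction i) (auto simp: batch_def)
        \<comment> \<open>The latest batch is willing to pay \<open>\<phi> y\<close>, so it has
          lifted the level to \<open>y\<close> up to one request.\<close>
        have "y - 1 / real M \<le> pm_level \<phi> (B @ batch M (?p (a * n)))"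
          using pos[of "a * n"] elim by (intro pm_level_batch_ge[OF mono fin y low']) (auto simp: B)
        then have "\<kappa> n * (y - 1 / real M - (1 - (1 + (real b - real a - 1) * \<kappa> n) / c))
          \<le> \<kappa> n * (pm_level \<phi> (ladder M ?p (a * n)) - (1 - (1 + (real b - real a - 1) * \<kappa> n) / c))"
          using \<kappa>_nonneg by (intro mult_left_mono) (auto simp: B)
        also have "\<dots> \<le> ?R c (\<kappa> n)"
          using elim(1) by (simp add: online_usage_PM \<kappa> algebra_simps)
        finally show ?case .
      qed
      moreover have "(\<lambda>M. \<kappa> n * (y - 1 / real M - (1 - (1 + (real b - real a - 1) * \<kappa> n) / c)))
          \<longlonglongrightarrow> \<kappa> n * (y - 0 - (1 - (1 + (real b - real a - 1) * \<kappa> n) / c))"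
        by (intro tendsto_intros lim_1_over_n)
      ultimately show ?thesis by (auto intro: tendsto_upperbound)
    qed
    have \<alpha>: "opt_ratio \<noteq> 0" using opt_ratio_ge_1 by linarith
    have "?L opt_ratio (\<kappa> n) \<le> ?R opt_ratio (\<kappa> n)" if "0 < n" for n
    proof (rule tendsto_le)
      show "((\<lambda>c. ?R c (\<kappa> n)) \<longlongrightarrow> ?R opt_ratio (\<kappa> n)) (at_right opt_ratio)"
        "((\<lambda>c. ?L c (\<kappa> n)) \<longlongrightarrow> ?L opt_ratio (\<kappa> n)) (at_right opt_ratio)"
        by (intro tendsto_intros \<alpha>)+
      show "\<forall>\<^sub>F c in at_right opt_ratio. ?L c (\<kappa> n) \<le> ?R c (\<kappa> n)"
        unfolding eventually_at_filter using c_bound that by (auto intro!: always_eventually)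
    qed simp
    then have "\<forall>\<^sub>F n in sequentially. ?L opt_ratio (\<kappa> n) \<le> ?R opt_ratio (\<kappa> n)"
      by (rule eventually_mono[OF eventually_gt_at_top])
    moreover have "(\<lambda>n. ?R opt_ratio (\<kappa> n)) \<longlonglongrightarrow> ?R opt_ratio (s / real b)"
      "(\<lambda>n. ?L opt_ratio (\<kappa> n)) \<longlonglongrightarrow> ?L opt_ratio (s / real b)"
      by (intro tendsto_intros \<alpha> \<kappa>_lim)+
    ultimately have lim: "?L opt_ratio (s / real b) \<le> ?R opt_ratio (s / real b)"
      by (intro tendsto_le[OF sequentially_bot])
    define u where "u = s / real b"
    have u: "0 < u" "real b * u = opt_ratio - 1" using s b by (auto simp: u_def s_def)
    have "u * (y - (1 - (1 + (real b - real a - 1) * u) / opt_ratio)) * opt_ratio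
        \<le> (1 - (1 + (real b - 1) * u) / opt_ratio) * opt_ratio"
      using lim opt_ratio_ge_1 unfolding u_def by (intro mult_right_mono) auto
    moreover have "u * (y - (1 - X / opt_ratio)) * opt_ratio = u * (y * opt_ratio - opt_ratio + X)"
      "(1 - X / opt_ratio) * opt_ratio = opt_ratio - X" for X
      using \<alpha> by (simp_all add: field_simps)
    ultimately have "u * (y * opt_ratio - opt_ratio + (1 + (real b - real a - 1) * u))
        \<le> opt_ratio - (1 + (real b - 1) * u)"
      by simp
    then have "u * (y * opt_ratio - opt_ratio + (1 + (real b * u - real a * u - u)))
        \<le> opt_ratio - (1 + (real b * u - u))"
      by (simp add: left_diff_distrib)
    \<comment> \<open>Since \<open>b * u = opt_ratio - 1\<close>, the right-hand side collapses to
      \<open>u\<close>: at the optimal ratio the slack is just one block, and dividing by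
      \<open>u\<close> gives the bound.\<close>
    then have "u * (y * opt_ratio - (real a + 1) * u) \<le> u * 1"
      unfolding u(2) by (simp add: algebra_simps)
    then have "y * opt_ratio - (real a + 1) * u \<le> 1" using u(1) by (rule mult_left_le_imp_le)
    then show ?thesis by (simp add: u_def mult.commute)
  qed
  \<comment> \<open>The strict \<open>t < s\<close> leaves room for rounding
    \<open>t * b / s\<close> up and adding one more block. Both together cost at most
    \<open>2 * s / b\<close>, which vanishes.\<close>
  have ev: "\<forall>\<^sub>F b in sequentially. t * real b / s + 2 \<le> real b"
    using eventually_ge_at_top[of "nat \<lceil>2 * s / (s - t)\<rceil>"]
  proof eventually_elim
    case (elim b)
    then have "2 * s / (s - t) \<le> real b" by linarith
    then show ?case using s by (simp add: field_simps)
  qed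
  have "\<forall>\<^sub>F b in sequentially. opt_ratio * y \<le> 1 + t + 2 * s / real b"
    using ev eventually_gt_at_top[of 0]
  proof eventually_elim
    case (elim b)
    define a where "a = nat \<lceil>t * real b / s\<rceil>"
    have "0 \<le> t * real b / s" using t s by simp
    then have a: "t * real b / s \<le> real a" "real a \<le> t * real b / s + 1"
      unfolding a_def by linarith+
    have "real (a + 1) \<le> real b" using a elim by simp
    then have ab: "a + 1 \<le> b" by linarith
    have "t \<le> s * real a / real b" using a(1) s elim by (simp add: field_simps)
    from bound[OF ab this] have "opt_ratio * y \<le> 1 + (real a + 1) * (s / real b)" .
    also have "(real a + 1) * (s / real b) \<le> (t * real b / s + 2) * (s / real b)"
      using a s by (intro mult_right_mono) auto
    also have "\<dots> = t + 2 * s / real b" using s elim by (simp add: field_simps)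
    finally show ?case by simp
  qed
  moreover have "(\<lambda>b. 1 + t + 2 * s / real b) \<longlonglongrightarrow> 1 + t" by real_asymp
  ultimately show ?thesis by (intro tendsto_lowerbound) auto
qed

subsection \<open>The optimal pricing function\<close>

definition threshold :: real where
  "threshold = 1 / opt_ratio"

lemma threshold_pos: "0 < threshold" and threshold_le_1: "threshold \<le> 1"
  using opt_ratio_ge_1 by (auto simp: threshold_def)

text \<open>\<open>max\<close> joins the flat and the exponential segment, which agree at
  \<open>threshold\<close>, so continuity and monotonicity are immediate. The price stays finite
  beyond 1, which spares the revenue estimates a capacity condition.\<close>

definition opt_price :: "real \<Rightarrow> real" where
  "opt_price y = (p_lo S - q) * exp (max 0 (y / threshold - 1)) + q"

definition opt_pricing :: "real \<Rightarrow> ereal" where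
  "opt_pricing = (\<lambda>y\<in>{0..}. if y < threshold then ereal (p_lo S)
     else if y \<le> 1 then ereal ((p_lo S - q) * exp (y / threshold - 1) + q) else \<infinity>)"

lemma opt_price_below: "y \<le> threshold \<Longrightarrow> opt_price y = p_lo S"
  using threshold_pos by (simp add: opt_price_def max_def field_simps)

lemma opt_price_above: "threshold \<le> y \<Longrightarrow> opt_price y = (p_lo S - q) * exp (y / threshold - 1) + q"
  using threshold_pos by (simp add: opt_price_def max_def field_simps)

lemma opt_pricing_eq: "0 \<le> y \<Longrightarrow> y \<le> 1 \<Longrightarrow> opt_pricing y = ereal (opt_price y)"
  by (simp add: opt_pricing_def opt_price_below opt_price_above)

lemma opt_price_mono: "x \<le> y \<Longrightarrow> opt_price x \<le> opt_price y"
proof -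
  assume "x \<le> y"
  then have "x / threshold \<le> y / threshold" using threshold_pos by (simp add: divide_right_mono)
  then show ?thesis using q_less by (auto simp: opt_price_def)
qed

lemma opt_price_ge: "p_lo S \<le> opt_price y"
  using opt_price_mono[of "min y threshold" y] by (simp add: opt_price_below)

lemma opt_price_1: "opt_price 1 = p_hi S"
  using opt_price_above[OF threshold_le_1] exp_opt_ratio by (simp add: threshold_def)

lemma pricing_function_opt: "pricing_function S opt_pricing"
  unfolding pricing_function_def
proof (intro conjI ballI allI impI)
  show "opt_pricing \<in> extensional {0..}" by (simp add: opt_pricing_def)
  have inf: "opt_pricing y = \<infinity>" if "1 < y" for y
    using that threshold_le_1 by (simp add: opt_pricing_def)
  show "opt_pricing y = \<infinity>" if "1 < y" for y by (rule inf[OF that])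
  show "mono_on {0..} opt_pricing"
  proof (rule mono_onI)
    fix x y :: real assume "x \<in> {0..}" "y \<in> {0..}" "x \<le> y"
    then show "opt_pricing x \<le> opt_pricing y"
      by (cases "y \<le> 1") (auto simp: opt_pricing_eq opt_price_mono inf)
  qed
  show "ereal (p_lo S) \<le> opt_pricing y" if "0 \<le> y" for y
    using that by (cases "y \<le> 1") (auto simp: opt_pricing_eq opt_price_ge inf)
  show "continuous (at_left y) opt_pricing" if y: "y \<in> {0<..1}" for y
  proof -
    have "isCont opt_price y" unfolding opt_price_def using threshold_pos
      by (intro continuous_intros) auto
    then have "(opt_price \<longlongrightarrow> opt_price y) (at_left y)"
      unfolding isCont_def by (rule filterlim_mono) (auto simp: at_le)
    then have "((\<lambda>x. ereal (opt_price x)) \<longlongrightarrow> opt_pricing y) (at_left y)"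
      using y by (simp add: opt_pricing_eq)
    moreover have "\<forall>\<^sub>F x in at_left y. ereal (opt_price x) = opt_pricing x"
      using y by (intro eventually_at_leftI[of 0]) (auto simp: opt_pricing_eq)
    ultimately show ?thesis
      unfolding continuous_within by (rule Lim_transform_eventually)
  qed
qed

lemma critical_threshold_opt: "critical_threshold S opt_pricing threshold"
  unfolding critical_threshold_def
proof (intro conjI ballI)
  show "threshold \<in> {0..1}" using threshold_pos threshold_le_1 by simp
  show "opt_pricing y = ereal (p_lo S)" if "y \<in> {0..<threshold}" for y
    using that by (simp add: opt_pricing_def)
  show "strict_mono_on {threshold..1} opt_pricing"
  proof (rule strict_mono_onI)
    fix x y assume xy: "x \<in> {threshold..1}" "y \<in> {threshold..1}" "x < y"
    then have "x / threshold < y / threshold" using threshold_pos by (simp add: divide_strict_right_mono)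
    then have "opt_price x < opt_price y" using xy q_less by (simp add: opt_price_above)
    then show "opt_pricing x < opt_pricing y" using xy threshold_pos by (simp add: opt_pricing_eq)
  qed
qed

section \<open>Revenue estimates\<close>

text \<open>The integral of \<open>opt_price - q\<close> from \<open>0\<close> to \<open>y\<close>.\<close>

definition revenue :: "real \<Rightarrow> real" where
  "revenue y = (if y < threshold then (p_lo S - q) * y
     else threshold * (p_lo S - q) * exp (y / threshold - 1))"

lemma revenue_above: "threshold \<le> y \<Longrightarrow> revenue y = threshold * (opt_price y - q)"
  by (simp add: revenue_def opt_price_above)

lemma revenue_below: "y \<le> threshold \<Longrightarrow> revenue y = (p_lo S - q) * y"
  using threshold_pos by (auto simp: revenue_def)

lemma exp_minus_one_le: "exp s - 1 \<le> s * exp s" for s :: real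
proof -
  have "(1 - s) * exp s \<le> exp (- s) * exp s"
    using exp_ge_add_one_self[of "- s"] by (intro mult_right_mono) auto
  then show ?thesis by (simp add: exp_minus algebra_simps)
qed

text \<open>Across a request of size \<open>r\<close> the margin grows by the factor
  \<open>exp (r / threshold)\<close>, which bounds the error of charging the initial price
  throughout.\<close>

lemma revenue_step_above:
  assumes "threshold \<le> y" "0 \<le> r"
  shows "revenue (y + r) - revenue y \<le> (opt_price y - q) * exp (r / threshold) * r"
proof -
  have split: "opt_price (y + r) - q = (opt_price y - q) * exp (r / threshold)"
    using assms by (simp add: opt_price_above add_divide_distrib exp_add[symmetric] algebra_simps)
  have "revenue (y + r) - revenue y = threshold * (opt_price y - q) * (exp (r / threshold) - 1)"
    using revenue_above[of y] revenue_above[of "y + r"] assms unfolding split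
    by (simp add: right_diff_distrib mult.assoc)
  also have "\<dots> \<le> threshold * (opt_price y - q) * (r / threshold * exp (r / threshold))"
    using threshold_pos opt_price_ge[of y] q_less by (intro mult_left_mono exp_minus_one_le) auto
  finally show ?thesis using threshold_pos by (simp add: mult_ac)
qed

lemma revenue_step:
  assumes "0 \<le> r"
  shows "revenue (y + r) - revenue y \<le> (opt_price y - q) * exp (r / threshold) * r"
proof -
  have exp1: "1 \<le> exp (r / threshold)" using assms threshold_pos by simp
  consider "threshold \<le> y" | "y + r \<le> threshold" | "y < threshold" "threshold < y + r" by linarith
  then show ?thesis
  proof cases
    case 1
    then show ?thesis using assms by (rule revenue_step_above)
  next
    case 2
    have "(p_lo S - q) * r * 1 \<le> (p_lo S - q) * r * exp (r / threshold)"
      using exp1 assms q_less by (intro mult_left_mono) auto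
    then show ?thesis using 2 assms by (simp add: revenue_below opt_price_below algebra_simps)
  next
    case 3
    \<comment> \<open>The part of the request beyond the kink; the two parts are estimated
      separately.\<close>
    define s where "s = y + r - threshold"
    have s: "0 \<le> s" "s \<le> r" using 3 by (auto simp: s_def)
    have "s / threshold \<le> r / threshold" using s threshold_pos by (simp add: divide_right_mono)
    then have "(p_lo S - q) * exp (s / threshold) * s \<le> (p_lo S - q) * exp (r / threshold) * s"
      using s q_less by (intro mult_right_mono mult_left_mono) auto
    moreover have "revenue (y + r) - revenue threshold \<le> (p_lo S - q) * exp (s / threshold) * s"
      using revenue_step_above[of threshold s] s by (simp add: s_def opt_price_below)
    moreover have "revenue threshold - revenue y = (p_lo S - q) * (r - s)"
      using 3 by (simp add: revenue_below s_def algebra_simps)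
    moreover have "(p_lo S - q) * (r - s) * 1 \<le> (p_lo S - q) * (r - s) * exp (r / threshold)"
      using exp1 s q_less by (intro mult_left_mono) auto
    ultimately show ?thesis using 3 by (simp add: opt_price_below algebra_simps)
  qed
qed

text \<open>The left-hand side is the tangent of \<open>revenue\<close> at 1, where the price is
  \<open>p_hi S\<close>. Revenue is convex, being the integral of a non-decreasing margin, and lies
  above it.\<close>

lemma revenue_ge:
  assumes "y \<le> 1"
  shows "(p_hi S - q) * (threshold - (1 - y)) \<le> revenue y"
proof -
  have top: "revenue 1 = threshold * (p_hi S - q)"
    using revenue_above[OF threshold_le_1] by (simp add: opt_price_1)
  have above: "(p_hi S - q) * (threshold - (1 - z)) \<le> revenue z" if z: "threshold \<le> z" "z \<le> 1" for z
  proof -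
    define x where "x = (1 - z) / threshold"
    have "opt_price z - q = (p_hi S - q) * exp (- x)"
      using z threshold_le_1
      by (simp add: opt_price_1[symmetric] opt_price_above x_def mult.assoc exp_add[symmetric] diff_divide_distrib)
    then have "revenue z = threshold * (p_hi S - q) * exp (- x)"
      using z by (simp add: revenue_above)
    moreover have "threshold * (p_hi S - q) * (1 - x) \<le> threshold * (p_hi S - q) * exp (- x)"
      using exp_ge_add_one_self[of "- x"] threshold_pos q_less p_lo_le by (intro mult_left_mono) auto
    moreover have "threshold * (p_hi S - q) * (1 - x) = (p_hi S - q) * (threshold - (1 - z))"
      using threshold_pos by (simp add: x_def field_simps)
    ultimately show ?thesis by simp
  qed
  show ?thesis
  proof (cases "threshold \<le> y")
    case True
    then show ?thesis using above assms by simp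
  next
    case False
    have "(p_lo S - q) * (threshold - y) \<le> (p_hi S - q) * (threshold - y)"
      using False p_lo_le by (intro mult_right_mono) auto
    moreover have "(p_hi S - q) * (threshold - (1 - threshold)) \<le> (p_lo S - q) * threshold"
      using above[of threshold] threshold_le_1 by (simp add: revenue_below)
    ultimately show ?thesis using False by (simp add: revenue_below algebra_simps)
  qed
qed

section \<open>Competitiveness by weak duality\<close>

text \<open>Here \<open>p\<close> is a price on capacity: each agent contributes at most her
  positive surplus at \<open>p\<close>, and the unit of capacity sold at \<open>p\<close> yields
  \<open>p - q\<close>.\<close>

lemma offline_welfare_dual:
  assumes A: "A \<in> instances S" and p: "q \<le> p"
  shows "offline_welfare S A \<le> (\<Sum>\<theta>\<leftarrow>A. max 0 (vln \<theta> - p * req \<theta>)) + (p - q)"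
proof (rule offline_welfare_le)
  fix X assume X: "X \<subseteq> {..<length A}" and u: "usage A X \<le> 1"
  have "0 \<le> req (A ! n)" if "n \<in> X" for n
  proof -
    have "A ! n \<in> agent_types S" using that X A by (auto simp: instances_def)
    then show ?thesis by (simp add: agent_types_def)
  qed
  then have u0: "0 \<le> usage A X" unfolding usage_def by (rule sum_nonneg)
  have "welfare S A X = (\<Sum>n\<in>X. vln (A ! n) - p * req (A ! n)) + (p - q) * usage A X"
    using u0 u by (simp add: welfare_def cost_linear sum_subtractf sum_distrib_left[symmetric]
        usage_def[symmetric] algebra_simps)
  also have "(\<Sum>n\<in>X. vln (A ! n) - p * req (A ! n))
      \<le> (\<Sum>n\<in>X. max 0 (vln (A ! n) - p * req (A ! n)))" by (rule sum_mono) simp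
  also have "\<dots> \<le> (\<Sum>n<length A. max 0 (vln (A ! n) - p * req (A ! n)))"
    using X by (intro sum_mono2) auto
  also have "\<dots> = (\<Sum>\<theta>\<leftarrow>A. max 0 (vln \<theta> - p * req \<theta>))"
    by (simp add: sum_list_sum_nth atLeast0LessThan)
  also have "(p - q) * usage A X \<le> (p - q) * 1" using p u by (intro mult_left_mono) auto
  finally show "welfare S A X \<le> (\<Sum>\<theta>\<leftarrow>A. max 0 (vln \<theta> - p * req \<theta>)) + (p - q)" by simp
qed

text \<open>\<open>D\<close> is the total utility of the accepted agents at the prices they were charged. As long as
  the capacity is not nearly exhausted, only the price can have caused a rejection.\<close>

lemma opt_pricing_invariant:
  assumes "A \<in> small_instances S \<epsilon>" "0 < \<epsilon>"
  defines "y \<equiv> pm_level opt_pricing A"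
  shows "\<exists>D\<ge>0. D + exp (- (\<epsilon> / threshold)) * revenue y
      \<le> online_value (decision (PM opt_pricing)) A - q * y \<and>
    (y \<le> 1 - \<epsilon> \<longrightarrow> (\<Sum>\<theta>\<leftarrow>A. max 0 (vln \<theta> - opt_price y * req \<theta>)) \<le> D) \<and>
    (y \<le> 1 - \<epsilon> \<and> y < threshold \<longrightarrow>
      online_value (decision (PM opt_pricing)) A - q * y = (\<Sum>\<theta>\<leftarrow>A. max 0 (vln \<theta> - q * req \<theta>)))"
  using assms(1) unfolding y_def
proof (induction A rule: rev_induct)
  case Nil
  then show ?case using threshold_pos by (auto simp: revenue_below)
next
  case (snoc \<theta> A)
  let ?alg = "decision (PM opt_pricing)"
  define y where "y = pm_level opt_pricing A"
  have A: "A \<in> small_instances S \<epsilon>" and \<theta>: "\<theta> \<in> agent_types S" "req \<theta> \<le> \<epsilon>"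
    using snoc.prems by auto
  from \<theta> have r: "0 < req \<theta>" and v: "p_lo S * req \<theta> \<le> vln \<theta>"
    by (auto simp: agent_types_def field_simps)
  have "q * req \<theta> \<le> p_lo S * req \<theta>" using q_less r by (intro mult_right_mono) auto
  with v have vq: "q * req \<theta> \<le> vln \<theta>" by linarith
  have y: "0 \<le> y" "y \<le> 1" unfolding y_def using A pm_level_le_1
    by (auto intro!: pm_level_nonneg simp: small_instances_def instances_def agent_types_def)
  obtain D where D: "0 \<le> D"
    and E: "D + exp (- (\<epsilon> / threshold)) * revenue y \<le> online_value ?alg A - q * y"
    and D1: "y \<le> 1 - \<epsilon> \<Longrightarrow> (\<Sum>\<theta>\<leftarrow>A. max 0 (vln \<theta> - opt_price y * req \<theta>)) \<le> D"
    and D2: "y \<le> 1 - \<epsilon> \<Longrightarrow> y < threshold \<Longrightarrow>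
      online_value ?alg A - q * y = (\<Sum>\<theta>\<leftarrow>A. max 0 (vln \<theta> - q * req \<theta>))"
    using snoc.IH[OF A] unfolding y_def by blast
  have acc: "pm_accepts opt_pricing y \<theta> \<longleftrightarrow> opt_price y * req \<theta> \<le> vln \<theta> \<and> y + req \<theta> \<le> 1"
    by (rule pm_accepts_iff[of opt_pricing y, OF opt_pricing_eq[OF y]])
  show ?case
  proof (cases "pm_accepts opt_pricing y \<theta>")
    case True
    let ?D = "D + (vln \<theta> - opt_price y * req \<theta>)"
    have lev: "pm_level opt_pricing (A @ [\<theta>]) = y + req \<theta>"
      and val: "online_value ?alg (A @ [\<theta>]) = online_value ?alg A + vln \<theta>"
      using True by (simp_all add: pm_level_snoc online_value_snoc decision_PM y_def)
    have ge: "opt_price y * req \<theta> \<le> vln \<theta>" using True acc by simp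
    \<comment> \<open>As \<open>req \<theta> \<le> \<epsilon>\<close>, the discount absorbs the
      factor \<open>exp (req \<theta> / threshold)\<close> lost in
      \<open>revenue_step\<close>.\<close>
    have "exp (- (\<epsilon> / threshold)) * (revenue (y + req \<theta>) - revenue y)
        \<le> exp (- (\<epsilon> / threshold)) * ((opt_price y - q) * exp (req \<theta> / threshold) * req \<theta>)"
      using r by (intro mult_left_mono revenue_step) auto
    also have "\<dots> = exp (req \<theta> / threshold - \<epsilon> / threshold) * ((opt_price y - q) * req \<theta>)"
      by (simp add: exp_diff exp_minus field_simps)
    also have "\<dots> \<le> 1 * ((opt_price y - q) * req \<theta>)"
      using \<theta> r opt_price_ge[of y] q_less threshold_pos
      by (intro mult_right_mono) (auto simp: divide_right_mono)
    finally have "?D + exp (- (\<epsilon> / threshold)) * revenue (y + req \<theta>)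
        \<le> online_value ?alg A + vln \<theta> - q * (y + req \<theta>)"
      using E by (simp add: algebra_simps)
    moreover have "(\<Sum>\<tau>\<leftarrow>A @ [\<theta>]. max 0 (vln \<tau> - opt_price (y + req \<theta>) * req \<tau>)) \<le> ?D"
      if cap: "y + req \<theta> \<le> 1 - \<epsilon>"
    proof -
      \<comment> \<open>A higher price can only reduce the surplus of the earlier agents, so the old
        \<open>D\<close> still covers them.\<close>
      have up: "opt_price y \<le> opt_price (y + req \<theta>)" using r by (intro opt_price_mono) simp
      have le: "max 0 (vln \<tau> - opt_price (y + req \<theta>) * req \<tau>) \<le> max 0 (vln \<tau> - opt_price y * req \<tau>)"
        if "\<tau> \<in> agent_types S" for \<tau>
      proof -
        have "0 \<le> req \<tau>" using that by (simp add: agent_types_def)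
        from mult_right_mono[OF up this] show ?thesis by auto
      qed
      have "(\<Sum>\<tau>\<leftarrow>A. max 0 (vln \<tau> - opt_price (y + req \<theta>) * req \<tau>))
          \<le> (\<Sum>\<theta>\<leftarrow>A. max 0 (vln \<theta> - opt_price y * req \<theta>))"
        using A by (intro sum_list_mono le) (auto simp: small_instances_def instances_def)
      also have "\<dots> \<le> D" using D1 cap r by simp
      finally show ?thesis using le[OF \<theta>(1)] ge by simp
    qed
    moreover have "online_value ?alg A + vln \<theta> - q * (y + req \<theta>)
        = (\<Sum>\<theta>\<leftarrow>A @ [\<theta>]. max 0 (vln \<theta> - q * req \<theta>))"
      if "y + req \<theta> \<le> 1 - \<epsilon>" "y + req \<theta> < threshold"
      using D2 that r vq by (simp add: algebra_simps)
    moreover have "0 \<le> ?D" using D ge by simp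
    ultimately show ?thesis unfolding lev val by blast
  next
    case False
    have lev: "pm_level opt_pricing (A @ [\<theta>]) = y"
      and val: "online_value ?alg (A @ [\<theta>]) = online_value ?alg A"
      using False by (simp_all add: pm_level_snoc online_value_snoc decision_PM y_def)
    have less: "vln \<theta> < opt_price y * req \<theta>" if "y \<le> 1 - \<epsilon>"
      using False acc that \<theta> by auto
    \<comment> \<open>Every agent can afford the price \<open>p_lo S\<close>, so before the
      threshold nobody is rejected while capacity remains.\<close>
    have "\<not> (y \<le> 1 - \<epsilon> \<and> y < threshold)"
      using less v by (auto simp: opt_price_below)
    moreover have "(\<Sum>\<theta>\<leftarrow>A @ [\<theta>]. max 0 (vln \<theta> - opt_price y * req \<theta>)) \<le> D" if "y \<le> 1 - \<epsilon>"
      using D1[OF that] less[OF that] by simp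
    ultimately show ?thesis unfolding lev val using D E by blast
  qed
qed

text \<open>The dual price depends on the final level \<open>y\<close>. Near exhaustion it is
  \<open>p_hi S\<close>, where no agent has surplus and the tangent bound on revenue pays for the
  capacity. Past the threshold it is the current price, where revenue is exactly
  \<open>threshold\<close> times the capacity term. Below the threshold it is \<open>q\<close>,
  where the bound equals the welfare of accepting everyone.\<close>

lemma opt_welfare_ratio_le:
  assumes \<epsilon>: "0 < \<epsilon>" "\<epsilon> < threshold" and A: "A \<in> small_instances S \<epsilon>"
  shows "welfare_ratio S (decision (PM opt_pricing)) A \<le> ereal (exp (\<epsilon> / threshold) / (threshold - \<epsilon>))"
proof (rule welfare_ratio_le)
  define y where "y = pm_level opt_pricing A"
  define E where "E = online_welfare S (decision (PM opt_pricing)) A"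
  define e where "e = exp (\<epsilon> / threshold)"
  have inst: "A \<in> instances S" using A by (simp add: small_instances_def)
  have E_eq: "E = online_value (decision (PM opt_pricing)) A - q * y"
    by (simp add: E_def y_def online_welfare_linear[OF online_algorithm_PM inst] online_usage_PM)
  have e: "1 \<le> e" "exp (- (\<epsilon> / threshold)) = 1 / e"
    using \<epsilon> by (auto simp: e_def exp_minus field_simps)
  have K: "1 \<le> e / (threshold - \<epsilon>)" using e \<epsilon> threshold_le_1 by simp
  then show "1 \<le> exp (\<epsilon> / threshold) / (threshold - \<epsilon>)" by (simp add: e_def)
  have "welfare S A {} = 0" by (simp add: welfare_def usage_def cost_linear)
  then show "0 \<le> offline_welfare S A"
    using offline_welfare_ge[of "{}" A S] by (simp add: usage_def)
  obtain D where D: "0 \<le> D" and DE: "D + revenue y / e \<le> E"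
    and D1: "y \<le> 1 - \<epsilon> \<Longrightarrow> (\<Sum>\<theta>\<leftarrow>A. max 0 (vln \<theta> - opt_price y * req \<theta>)) \<le> D"
    and D2: "y \<le> 1 - \<epsilon> \<Longrightarrow> y < threshold \<Longrightarrow> E = (\<Sum>\<theta>\<leftarrow>A. max 0 (vln \<theta> - q * req \<theta>))"
    using opt_pricing_invariant[OF A \<epsilon>(1)] unfolding y_def[symmetric] E_eq[symmetric] e(2) by auto
  have y: "y \<le> 1" unfolding y_def by (rule pm_level_le_1)
  have "(threshold - \<epsilon>) * offline_welfare S A \<le> e * E"
  proof -
    have nonneg: "0 \<le> threshold - \<epsilon>" using \<epsilon> by simp
    consider "1 - \<epsilon> < y" | "y \<le> 1 - \<epsilon>" "threshold \<le> y" | "y \<le> 1 - \<epsilon>" "y < threshold" by linarith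
    then show ?thesis
    proof cases
      case 1
      have "max 0 (vln \<theta> - p_hi S * req \<theta>) = 0" if "\<theta> \<in> set A" for \<theta>
      proof -
        have "\<theta> \<in> agent_types S" using that inst by (auto simp: instances_def)
        then show ?thesis by (auto simp: agent_types_def field_simps)
      qed
      then have "(\<Sum>\<theta>\<leftarrow>A. max 0 (vln \<theta> - p_hi S * req \<theta>)) = (\<Sum>\<theta>\<leftarrow>A. 0)"
        by (intro arg_cong[of _ _ sum_list] map_cong refl)
      then have "offline_welfare S A \<le> p_hi S - q"
        using offline_welfare_dual[OF inst, of "p_hi S"] q_less p_lo_le by simp
      then have "(threshold - \<epsilon>) * offline_welfare S A \<le> (threshold - \<epsilon>) * (p_hi S - q)"
        using nonneg by (rule mult_left_mono)
      also have "\<dots> = (p_hi S - q) * (threshold - \<epsilon>)" by (rule mult.commute)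
      also have "\<dots> \<le> (p_hi S - q) * (threshold - (1 - y))"
        using 1 q_less p_lo_le by (intro mult_left_mono) auto
      also have "\<dots> \<le> revenue y" by (rule revenue_ge[OF y])
      also have "\<dots> \<le> e * E" using DE D e by (simp add: field_simps) (smt (verit) mult_nonneg_nonneg)
      finally show ?thesis .
    next
      case 2
      have p: "q \<le> opt_price y" using opt_price_ge[of y] q_less by linarith
      have "offline_welfare S A \<le> D + (opt_price y - q)"
        using offline_welfare_dual[OF inst p] D1[OF 2(1)] by linarith
      then have "(threshold - \<epsilon>) * offline_welfare S A \<le> (threshold - \<epsilon>) * (D + (opt_price y - q))"
        using nonneg by (rule mult_left_mono)
      also have "\<dots> \<le> threshold * (D + (opt_price y - q))"
        using \<epsilon> D p by (intro mult_right_mono) auto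
      also have "\<dots> = threshold * D + revenue y" using 2 by (simp add: revenue_above distrib_left)
      also have "threshold * D \<le> e * D" using e threshold_le_1 D by (intro mult_right_mono) auto
      also have "e * D + revenue y \<le> e * E" using DE e by (simp add: field_simps)
      finally show ?thesis by simp
    next
      case 3
      have le: "offline_welfare S A \<le> E"
        using offline_welfare_dual[OF inst, of q] D2[OF 3] by simp
      have "0 \<le> E" using le \<open>0 \<le> offline_welfare S A\<close> by linarith
      then have "(threshold - \<epsilon>) * E \<le> e * E" using e \<epsilon> threshold_le_1 by (intro mult_right_mono) auto
      moreover have "(threshold - \<epsilon>) * offline_welfare S A \<le> (threshold - \<epsilon>) * E"
        using nonneg le by (intro mult_left_mono)
      ultimately show ?thesis by linarith
    qed
  qed
  then show "offline_welfare S A \<le> exp (\<epsilon> / threshold) / (threshold - \<epsilon>)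
      * online_welfare S (decision (PM opt_pricing)) A"
    using \<epsilon> by (simp add: E_def e_def field_simps)
qed

lemma competitive_ratio_opt_le: "competitive_ratio S (decision (PM opt_pricing)) \<le> ereal opt_ratio"
proof (rule tendsto_lowerbound)
  let ?K = "\<lambda>\<epsilon>. exp (\<epsilon> / threshold) / (threshold - \<epsilon>)"
  have "(?K \<longlongrightarrow> exp (0 / threshold) / (threshold - 0)) (at_right 0)"
    using threshold_pos by (intro tendsto_intros) auto
  then show "((\<lambda>\<epsilon>. ereal (?K \<epsilon>)) \<longlongrightarrow> ereal opt_ratio) (at_right 0)"
    by (simp add: threshold_def)
  show "\<forall>\<^sub>F \<epsilon> in at_right 0. competitive_ratio S (decision (PM opt_pricing)) \<le> ereal (?K \<epsilon>)"
  proof (rule eventually_at_rightI[of 0 threshold])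
    fix \<epsilon> assume "\<epsilon> \<in> {0<..<threshold}"
    then show "competitive_ratio S (decision (PM opt_pricing)) \<le> ereal (?K \<epsilon>)"
      unfolding competitive_ratio_def
      by (intro INF_lower2[of \<epsilon>] SUP_least opt_welfare_ratio_le) auto
  qed (rule threshold_pos)
qed simp

section \<open>Optimal ratio and uniqueness of the price\<close>

lemma optimal_ratio_eq: "optimal_ratio S = ereal opt_ratio"
  unfolding optimal_ratio_def
proof (rule antisym)
  show "(INF alg\<in>{alg. online_algorithm S alg}. competitive_ratio S alg) \<le> ereal opt_ratio"
    by (rule INF_lower2[of "decision (PM opt_pricing)"])
      (simp_all add: online_algorithm_PM competitive_ratio_opt_le)
qed (auto intro: INF_greatest competitive_ratio_ge)

text \<open>At \<open>t = opt_ratio * y - 1\<close> the upper and lower price bounds meet. Both are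
  available only under strict inequalities, so each is reached by a limit from the left.\<close>

lemma optimal_pricing_unique:
  assumes \<phi>: "pricing_function S \<phi>"
    and ratio: "competitive_ratio S (decision (PM \<phi>)) \<le> ereal opt_ratio"
  shows "\<phi> = opt_pricing"
proof (rule extensionalityI)
  show "\<phi> \<in> extensional {0..}" "opt_pricing \<in> extensional {0..}"
    using \<phi> pricing_function_opt by (auto simp: pricing_function_def)
  have ge: "ereal (p_lo S) \<le> \<phi> y" if "0 \<le> y" for y
    using \<phi> that by (simp add: pricing_function_def)
  fix y :: real assume "y \<in> {0..}"
  then have y0: "0 \<le> y" by simp
  consider "y < threshold" | "threshold \<le> y" "y \<le> 1" | "1 < y" by linarith
  then show "\<phi> y = opt_pricing y"
  proof cases
    case 1
    then have "opt_ratio * y < 1 + 0" using opt_ratio_ge_1 by (simp add: threshold_def field_simps)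
    then have "\<phi> y \<le> ereal (p_lo S)"
      using optimal_price_le[OF \<phi> ratio _ _ y0, of 0] opt_ratio_ge_1 by simp
    then show ?thesis using 1 y0 ge[OF y0] by (simp add: opt_pricing_def)
  next
    case 2
    define t where "t = opt_ratio * y - 1"
    have t: "0 \<le> t" "t \<le> opt_ratio - 1"
      using 2 opt_ratio_ge_1 by (auto simp: t_def threshold_def field_simps)
    have ypos: "0 < y" using 2 threshold_pos by linarith
    have opt: "opt_pricing y = ereal (q + (p_lo S - q) * exp t)"
      using 2 by (simp add: opt_pricing_def y0 t_def threshold_def mult.commute add.commute)
    \<comment> \<open>The upper bound applies at every \<open>x < y\<close>; left-continuity carries
      it to \<open>y\<close>.\<close>
    have "(\<phi> \<longlongrightarrow> \<phi> y) (at_left y)"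
      using \<phi> 2 ypos by (auto simp: pricing_function_def continuous_within)
    moreover have "\<forall>\<^sub>F x in at_left y. \<phi> x \<le> opt_pricing y"
    proof (rule eventually_at_leftI[OF _ ypos])
      fix x assume x: "x \<in> {0<..<y}"
      then have "opt_ratio * x < 1 + t" using opt_ratio_ge_1 by (simp add: t_def)
      then show "\<phi> x \<le> opt_pricing y"
        using optimal_price_le[OF \<phi> ratio t] x by (simp add: opt)
    qed
    ultimately have "\<phi> y \<le> opt_pricing y" by (rule tendsto_upperbound) simp
    moreover have "opt_pricing y \<le> \<phi> y"
    proof (cases "t = 0")
      case True
      then show ?thesis using ge[OF y0] by (simp add: opt)
    next
      case False
      have low: "opt_ratio * y \<le> 1 + t'" if "0 \<le> t'" "t' < t" "\<phi> y \<le> ereal (q + (p_lo S - q) * exp t')" for t'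
        using optimal_price_ge[OF \<phi> ratio _ _ y0 _ that(3)] that t 2 by simp
      \<comment> \<open>Otherwise \<open>low\<close> would give \<open>1 + t \<le> 1 + t'\<close>,
        against \<open>t' < t\<close>.\<close>
      have "ereal (q + (p_lo S - q) * exp t') \<le> \<phi> y" if "0 \<le> t'" "t' < t" for t'
        using low[OF that] that by (fastforce simp: t_def)
      then have "\<forall>\<^sub>F t' in at_left t. ereal (q + (p_lo S - q) * exp t') \<le> \<phi> y"
        using False t by (intro eventually_at_leftI[of 0]) auto
      moreover have "((\<lambda>t'. ereal (q + (p_lo S - q) * exp t')) \<longlongrightarrow> opt_pricing y) (at_left t)"
        unfolding opt by (intro tendsto_intros)
      ultimately show ?thesis by (intro tendsto_upperbound) auto
    qed
    ultimately show ?thesis by (rule antisym)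
  next
    case 3
    then show ?thesis using \<phi> pricing_function_opt by (simp add: pricing_function_def)
  qed
qed

end

text \<open>The one-sided derivative at 0 is a limit of difference quotients that all equal
  \<open>q\<close>, so uniqueness of limits identifies it with \<open>q\<close>.\<close>

lemma nice_linear_slope_less:
  assumes nice: "nice S" and linear: "\<forall>y\<in>{0..1}. cost S y = q * y"
  shows "q < p_lo S"
proof -
  obtain D where D: "(cost S has_real_derivative D) (at 0 within {0..1})" "D < p_lo S"
    using nice by (auto simp: nice_def)
  have "((\<lambda>y. (cost S y - cost S 0) / (y - 0)) \<longlongrightarrow> D) (at_right 0)"
    using D(1) by (simp add: has_field_derivative_iff at_within_Icc_at_right)
  moreover have "\<forall>\<^sub>F y in at_right 0. (cost S y - cost S 0) / (y - 0) = q"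
    using linear by (intro eventually_at_rightI[of 0 1]) auto
  ultimately have "((\<lambda>_. q) \<longlongrightarrow> D) (at_right (0 :: real))"
    by (rule Lim_transform_eventually)
  then have "q = D" by (simp add: tendsto_const_iff)
  then show ?thesis using D(2) by simp
qed

theorem corollary2:
  fixes S :: pricing_setup and q \<alpha> \<omega> :: real and \<phi>s :: "real \<Rightarrow> ereal"
  assumes nice: "nice S"
    and q: "q \<ge> 0"
    and linear: "\<forall>y\<in>{0..1}. cost S y = q * y"
    and \<alpha>: "\<alpha> = 1 + ln ((p_hi S - q) / (p_lo S - q))"
    and \<omega>: "\<omega> = 1 / \<alpha>"
    and \<phi>s: "\<phi>s = (\<lambda>y\<in>{0..}.
               if y < \<omega> then ereal (p_lo S)
               else if y \<le> 1 then ereal ((p_lo S - q) * exp (y / \<omega> - 1) + q)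
               else \<infinity>)"
  shows "optimal_ratio S = ereal \<alpha> \<and>
    (pricing_function S \<phi>s \<and> incentive_compatible S (PM \<phi>s) \<and>
      competitive S (optimal_ratio S) (decision (PM \<phi>s))) \<and>
    (\<exists>!\<phi>. pricing_function S \<phi> \<and> incentive_compatible S (PM \<phi>) \<and>
      competitive S (optimal_ratio S) (decision (PM \<phi>))) \<and>
    critical_threshold S \<phi>s \<omega>"
proof -
  interpret linear_setup S q
    using q nice linear nice_linear_slope_less[OF nice linear]
    by unfold_locales (auto simp: nice_def)
  have \<alpha>_eq: "\<alpha> = opt_ratio" by (simp add: \<alpha> opt_ratio_def)
  then have \<omega>_eq: "\<omega> = threshold" by (simp add: \<omega> threshold_def)
  have "\<phi>s = opt_pricing" unfolding \<phi>s opt_pricing_def \<omega>_eq ..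
  note eqs = \<alpha>_eq \<omega>_eq this
  have "0 \<le> opt_pricing y" if "0 \<le> y" for y
  proof -
    have "0 \<le> ereal (p_lo S)" using q q_less by simp
    also have "\<dots> \<le> opt_pricing y"
      using pricing_function_opt that by (simp add: pricing_function_def)
    finally show ?thesis .
  qed
  then have ic: "incentive_compatible S (PM opt_pricing)" by (rule incentive_compatible_PM)
  have comp: "competitive S (optimal_ratio S) (decision (PM opt_pricing))"
    by (simp add: competitive_def optimal_ratio_eq online_algorithm_PM competitive_ratio_opt_le)
  have "\<phi> = opt_pricing"
    if "pricing_function S \<phi>" "competitive S (optimal_ratio S) (decision (PM \<phi>))" for \<phi>
    using that optimal_pricing_unique by (simp add: competitive_def optimal_ratio_eq)
  then show ?thesis
    unfolding eqs using optimal_ratio_eq pricing_function_opt ic comp critical_threshold_opt by blast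
qed

end
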